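(* Let $\mathbf{k}$ be a field of characteristic zero, let $S=\mathbb{Z}_{\ge 0}^n$ be the first octant, and let $I\subset\mathbf{k}[S]$ be a full monomial ideal with cofinite support. Let $\tau\in\operatorname{Aut}(S,I)$ be a toric automorphism of $\mathbf{k}[S]/I$. Then $\tau\in\operatorname{Aut}^0_{\mathbf{k}}(\mathbf{k}[S]/I)$ if and only if $\tau$ is a product of toric transpositions $\tau_{i_1j_1}\cdots\tau_{i_kj_k}$ with $\tau_{i_\ell j_\ell}\in\operatorname{Aut}^0_{\mathbf{k}}(\mathbf{k}[S]/I)$ for all $\ell=1,\ldots,k$.
   Context: $\mathbf{k}[S]=\mathbf{k}[x_1,\dots,x_n]$, with $\mathbf{x}^m=x_1^{m_1}\cdots x_n^{m_n}$, and $e_1,\dots,e_n$ is the standard basis of $\mathbb{Z}^n$. A monomial ideal is one generated by finitely many monomials; $\operatorname{supp}(I)=\{m\in S\mid\mathbf{x}^m\in I\}$. $I$ has cofinite support if $S\setminus\operatorname{supp}(I)$ is finite. $I$ is full if no $e_i$ lies in $\operatorname{supp}(I)$. $\operatorname{Aut}_{\mathbf{k}}(\mathbf{k}[S]/I)$ is the group of $\mathbf{k}$-algebra automorphisms, a linear algebraic group, and $\operatorname{Aut}^0_{\mathbf{k}}$ is its identity component. A toric automorphism of $\mathbf{k}[S]/I$ is an automorphism of the form $\overline{\mathbf{x}}^m\mapsto\overline{\mathbf{x}}^{\widehat g(m)}$ for a semigroup automorphism $\widehat g\colon S\to S$ with $\widehat g(\operatorname{supp}(I))=\operatorname{supp}(I)$;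 $\operatorname{Aut}(S,I)$ is the group of toric automorphisms. For $i\ne j$, the toric transposition $\tau_{ij}$ is the toric automorphism induced by the semigroup automorphism exchanging $e_i$ and $e_j$ and fixing the other $e_k$, when that semigroup automorphism preserves $\operatorname{supp}(I)$. The empty product (identity) is allowed. *)

theory Defs
  imports
    "HOL-Library.Poly_Mapping"
    "HOL-Algebra.Algebraic_Closure_Type"
    "HOL-Algebra.Bij"
    "HOL-Analysis.Abstract_Topological_Spaces"
begin

text \<open>
  The first octant \<open>S = \<int>\<^sub>\<ge>\<^sub>0\<^sup>n\<close> is the type of maps from a finite index type \<open>'n\<close> to \<open>nat\<close>,
  and \<open>k[S]\<close> is its monoid algebra, with the convolution product of \<^theory>\<open>HOL-Library.Poly_Mapping\<close>.
\<close>

type_synonym 'n octant = "'n \<Rightarrow>\<^sub>0 nat"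
type_synonym ('n, 'k) octant_algebra = "'n octant \<Rightarrow>\<^sub>0 'k"

abbreviation std_basis :: "'n::finite \<Rightarrow> 'n octant" where
  "std_basis i \<equiv> Poly_Mapping.single i 1"

abbreviation monomial :: "'n::finite octant \<Rightarrow> ('n, 'k::field) octant_algebra" where
  "monomial m \<equiv> Poly_Mapping.single m 1"

abbreviation kS :: "('n::finite, 'k::field) octant_algebra ring" where
  "kS \<equiv> ring_of_type_algebra"


subsection \<open>Monomial ideals\<close>

definition monomial_ideal :: "('n::finite, 'k::field) octant_algebra set \<Rightarrow> bool" where
  "monomial_ideal I \<longleftrightarrow> (\<exists>M. finite M \<and> I = Idl\<^bsub>kS\<^esub> (monomial ` M))"

definition supp :: "('n::finite, 'k::field) octant_algebra set \<Rightarrow> 'n octant set" where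
  "supp I = {m. monomial m \<in> I}"

definition cofinite_support :: "('n::finite, 'k::field) octant_algebra set \<Rightarrow> bool" where
  "cofinite_support I \<longleftrightarrow> finite (UNIV - supp I)"

definition full :: "('n::finite, 'k::field) octant_algebra set \<Rightarrow> bool" where
  "full I \<longleftrightarrow> (\<forall>i. std_basis i \<notin> supp I)"


subsection \<open>The quotient algebra and its automorphism group\<close>

abbreviation quot_alg ::
    "('n::finite, 'k::field) octant_algebra set \<Rightarrow> ('n, 'k) octant_algebra set ring" where
  "quot_alg I \<equiv> kS Quot I"

abbreviation residue ::
    "('n::finite, 'k::field) octant_algebra set \<Rightarrow> ('n, 'k) octant_algebra
      \<Rightarrow> ('n, 'k) octant_algebra set" where
  "residue I p \<equiv> I +>\<^bsub>kS\<^esub> p"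

text \<open>The structure map of the \<open>k\<close>-algebra \<open>k[S]/I\<close>.\<close>

definition scalar ::
    "('n::finite, 'k::field) octant_algebra set \<Rightarrow> 'k \<Rightarrow> ('n, 'k) octant_algebra set" where
  "scalar I c = residue I (Poly_Mapping.single 0 c)"

text \<open>
  As for \<^const>\<open>auto\<close>, automorphisms are extensional functions on the carrier, so that each
  automorphism is represented by exactly one function.
\<close>

definition alg_auto ::
    "('n::finite, 'k::field) octant_algebra set
      \<Rightarrow> (('n, 'k) octant_algebra set \<Rightarrow> ('n, 'k) octant_algebra set) set" where
  "alg_auto I = {f \<in> ring_hom (quot_alg I) (quot_alg I) \<inter> Bij (carrier (quot_alg I)).
     \<forall>c. f (scalar I c) = scalar I c}"

definition Aut ::
    "('n::finite, 'k::field) octant_algebra set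
      \<Rightarrow> (('n, 'k) octant_algebra set \<Rightarrow> ('n, 'k) octant_algebra set) monoid" where
  "Aut I = BijGroup (carrier (quot_alg I)) \<lparr>carrier := alg_auto I\<rparr>"


subsection \<open>The Zariski topology and the identity component\<close>

definition linear_functional ::
    "('n::finite, 'k::field) octant_algebra set \<Rightarrow> (('n, 'k) octant_algebra set \<Rightarrow> 'k) \<Rightarrow> bool" where
  "linear_functional I l \<longleftrightarrow>
     (\<forall>a\<in>carrier (quot_alg I). \<forall>b\<in>carrier (quot_alg I). l (a \<oplus>\<^bsub>quot_alg I\<^esub> b) = l a + l b) \<and>
     (\<forall>c. \<forall>a\<in>carrier (quot_alg I). l (scalar I c \<otimes>\<^bsub>quot_alg I\<^esub> a) = c * l a)"

text \<open>
  When \<open>k[S]/I\<close> is finite-dimensional, the functions \<open>f \<mapsto> l (f a)\<close>, with \<open>l\<close> a linear functional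
  and \<open>a\<close> a vector, span the linear forms on the space of its \<open>k\<close>-linear endomorphisms. The
  functions below are thus the polynomials in the matrix entries with respect to any basis. The
  coordinate ring of \<open>GL\<close> also contains the inverse of the determinant, but clearing denominators
  shows that it has the same zero sets.
\<close>

inductive_set polynomial_functions ::
    "('n::finite, 'k::field) octant_algebra set
      \<Rightarrow> ((('n, 'k) octant_algebra set \<Rightarrow> ('n, 'k) octant_algebra set) \<Rightarrow> 'k) set"
  for I where
  const: "(\<lambda>f. c) \<in> polynomial_functions I"
| entry: "linear_functional I l \<Longrightarrow> a \<in> carrier (quot_alg I) \<Longrightarrow>
    (\<lambda>f. l (f a)) \<in> polynomial_functions I"
| add: "P \<in> polynomial_functions I \<Longrightarrow> Q \<in> polynomial_functions I \<Longrightarrow>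
    (\<lambda>f. P f + Q f) \<in> polynomial_functions I"
| mult: "P \<in> polynomial_functions I \<Longrightarrow> Q \<in> polynomial_functions I \<Longrightarrow>
    (\<lambda>f. P f * Q f) \<in> polynomial_functions I"

definition zariski ::
    "('n::finite, 'k::field) octant_algebra set
      \<Rightarrow> (('n, 'k) octant_algebra set \<Rightarrow> ('n, 'k) octant_algebra set) topology" where
  "zariski I = topology_generated_by
     ((\<lambda>P. {f \<in> carrier (Aut I). P f \<noteq> 0}) ` polynomial_functions I)"

text \<open>
  This is the identity component of the group of \<open>k\<close>-rational points. Over a field of
  characteristic zero it is also the group of \<open>k\<close>-rational points of the identity component
  of the group scheme, since the rational points of a connected linear algebraic group are then
  dense in it.
\<close>

definition Aut0 ::
    "('n::finite, 'k::field) octant_algebra set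
      \<Rightarrow> (('n, 'k) octant_algebra set \<Rightarrow> ('n, 'k) octant_algebra set) set" where
  "Aut0 I = connected_component_of_set (zariski I) \<one>\<^bsub>Aut I\<^esub>"


subsection \<open>Toric automorphisms\<close>

definition octant_auto :: "('n::finite octant \<Rightarrow> 'n octant) \<Rightarrow> bool" where
  "octant_auto g \<longleftrightarrow> bij g \<and> (\<forall>m m'. g (m + m') = g m + g m')"

definition toric_induced ::
    "('n::finite, 'k::field) octant_algebra set \<Rightarrow> ('n octant \<Rightarrow> 'n octant)
      \<Rightarrow> (('n, 'k) octant_algebra set \<Rightarrow> ('n, 'k) octant_algebra set) \<Rightarrow> bool" where
  "toric_induced I g f \<longleftrightarrow> octant_auto g \<and> g ` supp I = supp I \<and> f \<in> carrier (Aut I) \<and>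
     (\<forall>m. f (residue I (monomial m)) = residue I (monomial (g m)))"

definition toric_auto ::
    "('n::finite, 'k::field) octant_algebra set
      \<Rightarrow> (('n, 'k) octant_algebra set \<Rightarrow> ('n, 'k) octant_algebra set) set" where
  "toric_auto I = {f. \<exists>g. toric_induced I g f}"

definition toric_transposition ::
    "('n::finite, 'k::field) octant_algebra set \<Rightarrow> 'n \<Rightarrow> 'n
      \<Rightarrow> (('n, 'k) octant_algebra set \<Rightarrow> ('n, 'k) octant_algebra set) \<Rightarrow> bool" where
  "toric_transposition I i j f \<longleftrightarrow> i \<noteq> j \<and>
     (\<exists>g. g (std_basis i) = std_basis j \<and> g (std_basis j) = std_basis i \<and>
          (\<forall>k. k \<noteq> i \<longrightarrow> k \<noteq> j \<longrightarrow> g (std_basis k) = std_basis k) \<and>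
          toric_induced I g f)"

end

theory Submission
  imports Defs "HOL-Analysis.Determinants"
begin

text \<open>
  Write \<open>i \<rightarrow> j\<close> if replacing one factor \<open>x\<^sub>i\<close> by \<open>x\<^sub>j\<close> in a monomial of \<open>I\<close> always gives a monomial
  of \<open>I\<close> again (\<open>replaceable i j\<close> below). This is a preorder on the variables. The proof rests on the
  fact that a toric automorphism permuting the variables by \<open>\<sigma>\<close> lies in the identity component if and
  only if \<open>i\<close> and \<open>\<sigma> i\<close> are equivalent for this preorder, for every \<open>i\<close>. A permutation that
  preserves equivalence classes is a product of transpositions of equivalent variables, and the
  theorem follows, because the identity component is closed under multiplication.

  \<^item> If \<open>i\<close> and \<open>j\<close> are equivalent, then \<open>GL\<^sub>2\<close> acts on \<open>k[S]/I\<close> through \<open>x\<^sub>i\<close> and \<open>x\<^sub>j\<close>. The line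
  \<open>(1 - t) id + t \<tau>\<^sub>i\<^sub>j\<close> of linear substitutions has determinant \<open>1 - 2t\<close>, so it gives automorphisms
  for all \<open>t \<noteq> 1/2\<close>. The polynomial functions restrict to polynomials in \<open>t\<close>, so the line is
  connected, like every cofinite subset of the affine line over an infinite field. It joins the identity to \<open>\<tau>\<^sub>i\<^sub>j\<close>
  (\<open>toric_transposition_in_Aut0\<close>).

  \<^item> Every automorphism \<open>f\<close> acts on the cotangent space of the local algebra \<open>k[S]/I\<close>, which has the
  variables as a basis; let \<open>a\<^sub>i\<^sub>j\<close> be the entries of its matrix, and \<open>b\<^sub>i\<^sub>j\<close> those of the matrix of the
  inverse of \<open>f\<close>. The derivation \<open>x\<^sub>k \<partial>/\<partial>x\<^sub>k\<close> preserves the monomial ideal \<open>I\<close>, so its conjugate under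
  \<open>f\<close> is again a derivation of \<open>k[S]/I\<close>. The linear part of the conjugate has the entries
  \<open>a\<^sub>i\<^sub>k b\<^sub>k\<^sub>j\<close>, and in characteristic zero a derivation of \<open>k[S]/I\<close> can have a nonzero entry at \<open>(i, j)\<close>
  only if \<open>i \<rightarrow> j\<close> (\<open>leibniz_mod_replaceable\<close>). So \<open>a\<^sub>i\<^sub>k b\<^sub>k\<^sub>j \<noteq> 0\<close> implies \<open>i \<rightarrow> j\<close>.

  \<^item> It follows that the automorphisms whose linear part is block triangular (\<open>a\<^sub>i\<^sub>k \<noteq> 0\<close> only if
  \<open>i \<rightarrow> k\<close>) form an open set: they are those for which some permutation \<open>\<pi>\<close>
  with \<open>i \<rightarrow> \<pi> i\<close> for all \<open>i\<close> picks only nonzero entries at the places \<open>(i, \<pi> i)\<close>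
  (\<open>respects_replaceable_iff_matching\<close>). By definition they also form a closed set. So they contain
  the identity component. A permutation matrix that is block triangular in this sense satisfies \<open>i \<rightarrow> \<sigma> i\<close>, and going around the cycles of \<open>\<sigma>\<close> gives
  \<open>\<sigma> i \<rightarrow> i\<close> as well.
\<close>

abbreviation lookup :: "('a \<Rightarrow>\<^sub>0 'b::zero) \<Rightarrow> 'a \<Rightarrow> 'b" where
  "lookup \<equiv> Poly_Mapping.lookup"

abbreviation keys :: "('a \<Rightarrow>\<^sub>0 'b::zero) \<Rightarrow> 'a set" where
  "keys \<equiv> Poly_Mapping.keys"

abbreviation cst :: "'k::field \<Rightarrow> ('n::finite, 'k) octant_algebra" where
  "cst c \<equiv> Poly_Mapping.single 0 c"

abbreviation var :: "'n::finite \<Rightarrow> ('n, 'k::field) octant_algebra" where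
  "var i \<equiv> monomial (std_basis i)"

section \<open>Polynomials on the octant\<close>

\<comment> \<open>The simplifier would otherwise rewrite \<open>std_basis i = Poly_Mapping.single i 1\<close> to a form with \<open>Suc 0\<close>,
  to which lemmas about \<open>std_basis\<close> do not apply.\<close>
declare One_nat_def [simp del]

lemma poly_mapping_eq_sum_single:
  fixes p :: "'a \<Rightarrow>\<^sub>0 'b::comm_monoid_add"
  shows "p = (\<Sum>m\<in>keys p. Poly_Mapping.single m (lookup p m))"
proof (rule poly_mapping_eqI)
  fix k
  have "lookup (\<Sum>m\<in>keys p. Poly_Mapping.single m (lookup p m)) k
      = (\<Sum>m\<in>keys p. if k = m then lookup p k else 0)"
    by (subst lookup_sum) (auto intro!: sum.cong simp: lookup_single when_def)
  then show "lookup p k = lookup (\<Sum>m\<in>keys p. Poly_Mapping.single m (lookup p m)) k"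
    by (simp add: in_keys_iff)
qed

lemma poly_mapping_additive_induct [case_names zero add single]:
  fixes p :: "'a \<Rightarrow>\<^sub>0 'b::comm_monoid_add"
  assumes "P 0" and "\<And>p q. P p \<Longrightarrow> P q \<Longrightarrow> P (p + q)" and "\<And>m c. P (Poly_Mapping.single m c)"
  shows "P p"
proof -
  have "P (\<Sum>m\<in>A. Poly_Mapping.single m (lookup p m))" if "finite A" for A
    using that by (induction A) (auto intro: assms)
  then show ?thesis
    by (subst poly_mapping_eq_sum_single) simp
qed

lemma octant_split:
  fixes m :: "'n::finite octant"
  assumes "lookup m i > 0"
  obtains m' where "m = std_basis i + m'"
proof
  show "m = std_basis i + (m - std_basis i)"
    using assms by (intro poly_mapping_eqI) (auto simp: lookup_add lookup_minus lookup_single when_def)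
qed

lemma octant_nonzero_split:
  fixes m :: "'n::finite octant"
  assumes "m \<noteq> 0"
  obtains i m' where "m = std_basis i + m'"
proof -
  obtain i where "lookup m i > 0"
    using assms by (metis bot_nat_0.not_eq_extremum lookup_zero poly_mapping_eqI)
  then show ?thesis
    using octant_split that by metis
qed

lemma octant_induct [case_names zero step]:
  fixes m :: "'n::finite octant"
  assumes "P 0" and "\<And>i m. P m \<Longrightarrow> P (std_basis i + m)"
  shows "P m"
proof (induction "\<Sum>i\<in>UNIV. lookup m i" arbitrary: m)
  case 0
  then have "m = 0"
    by (intro poly_mapping_eqI) simp
  then show ?case
    using assms(1) by simp
next
  case (Suc d)
  then have "m \<noteq> 0"
    by auto
  then obtain i m' where m: "m = std_basis i + m'"
    by (rule octant_nonzero_split)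
  then have "d = (\<Sum>i\<in>UNIV. lookup m' i)"
    using Suc(2) by (simp add: lookup_add sum.distrib lookup_single when_def)
  then show ?case
    using Suc(1) assms(2) m by blast
qed

lemma octant_add_eq_0_iff: "a + b = 0 \<longleftrightarrow> a = 0 \<and> b = 0" for a b :: "'n::finite octant"
  by (auto simp: poly_mapping_eq_iff fun_eq_iff lookup_add)

lemma std_basis_nonzero [simp]: "std_basis i \<noteq> 0"
  by (metis lookup_single_eq lookup_zero one_neq_zero)

lemma std_basis_inject [simp]: "std_basis i = std_basis j \<longleftrightarrow> i = j"
  by (metis lookup_single_eq lookup_single_not_eq zero_neq_one)

text \<open>
  The standard basis vectors are the atoms of the octant. This is why products contribute to a
  linear coefficient only through a constant term, and why every semigroup automorphism permutes
  the standard basis.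
\<close>

lemma add_eq_std_basis_iff:
  fixes a b :: "'n::finite octant"
  shows "a + b = std_basis j \<longleftrightarrow> a = 0 \<and> b = std_basis j \<or> a = std_basis j \<and> b = 0"
proof
  assume ab: "a + b = std_basis j"
  show "a = 0 \<and> b = std_basis j \<or> a = std_basis j \<and> b = 0"
  proof (cases "a = 0")
    case False
    then obtain i a' where "a = std_basis i + a'"
      by (rule octant_nonzero_split)
    then have eq: "std_basis i + (a' + b) = std_basis j"
      using ab by (simp add: add.assoc)
    have "i = j"
    proof (rule ccontr)
      assume "i \<noteq> j"
      then show False
        using arg_cong[OF eq, of "\<lambda>m. lookup m i"] by (simp add: lookup_add lookup_single when_def)
    qed
    then have "a' + b = 0"
      using eq by simp
    then show ?thesis
      using \<open>a = _\<close> \<open>i = j\<close> by (simp add: octant_add_eq_0_iff)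
  qed (use ab in simp)
qed auto

lemma lookup_single_mult:
  fixes a :: "'a::cancel_comm_monoid_add" and c :: "'k::semiring_0"
  shows "lookup (Poly_Mapping.single a c * p) (a + b) = c * lookup p b"
  by (induction p rule: poly_mapping_additive_induct)
     (simp_all add: distrib_left lookup_add mult_single lookup_single when_def)

lemma lookup_single_mult_eq_0:
  fixes a :: "'a::cancel_comm_monoid_add" and c :: "'k::semiring_0"
  assumes "\<And>b. n \<noteq> a + b"
  shows "lookup (Poly_Mapping.single a c * p) n = 0"
  using assms by (induction p rule: poly_mapping_additive_induct)
     (auto simp: distrib_left lookup_add mult_single lookup_single when_def)

lemma lookup_mult_0:
  fixes p q :: "('n::finite, 'k::field) octant_algebra"
  shows "lookup (p * q) 0 = lookup p 0 * lookup q 0"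
proof (induction p rule: poly_mapping_additive_induct)
  case (single m c)
  show ?case
    by (induction q rule: poly_mapping_additive_induct)
       (auto simp: distrib_left lookup_add mult_single lookup_single when_def octant_add_eq_0_iff)
qed (simp_all add: distrib_right lookup_add)

text \<open>
  The Leibniz rule for the derivative along \<open>x\<^sub>j\<close> at the origin.
\<close>

lemma lookup_mult_std_basis:
  fixes p q :: "('n::finite, 'k::field) octant_algebra"
  shows "lookup (p * q) (std_basis j) =
    lookup p 0 * lookup q (std_basis j) + lookup p (std_basis j) * lookup q 0"
proof (induction p rule: poly_mapping_additive_induct)
  case (single m c)
  show ?case
  proof (induction q rule: poly_mapping_additive_induct)
    case (single m' c')
    have "std_basis j \<noteq> 0"
      by simp
    then show ?case
      using add_eq_std_basis_iff[of m m' j]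
      by (auto simp: mult_single lookup_single when_def simp del: std_basis_nonzero)
  qed (simp_all add: distrib_left lookup_add algebra_simps)
qed (simp_all add: distrib_right lookup_add algebra_simps)

lemma monomial_add: "monomial (a + b) = monomial a * monomial b"
  by (simp add: mult_single)

lemma single_eq_cst_mult: "Poly_Mapping.single m c = cst c * monomial m"
  by (simp add: mult_single)

section \<open>The quotient by a full monomial ideal of cofinite support\<close>

lemma ideal_genideal: "ideal (Idl\<^bsub>kS\<^esub> A) (kS :: ('n::finite, 'k::field) octant_algebra ring)"
  by (rule ring.genideal_ideal[OF ring_from_type_algebra]) (simp add: ring_of_type_algebra_def)

locale full_monomial_ideal =
  fixes I :: "('n::finite, 'k::field_char_0) octant_algebra set"
  assumes monomial_ideal: "monomial_ideal I"
    and cofinite_support: "cofinite_support I"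
    and full: "full I"
begin

lemma ideal: "ideal I kS"
  using monomial_ideal ideal_genideal unfolding monomial_ideal_def by auto

lemma abelian_subgroup: "abelian_subgroup I kS"
  using ideal by (simp add: ideal.is_ideal abelian_subgroupI3 ideal_def ring_def
    additive_subgroup.intro)

lemma ideal_add: "p \<in> I \<Longrightarrow> q \<in> I \<Longrightarrow> p + q \<in> I"
  using additive_subgroup.a_closed[OF ideal.axioms(1)[OF ideal]] by (simp add: ring_of_type_algebra_def)

lemma ideal_mult_left: "p \<in> I \<Longrightarrow> q * p \<in> I"
  using ideal.I_l_closed[OF ideal] by (simp add: ring_of_type_algebra_def)

lemma ideal_mult_right: "p \<in> I \<Longrightarrow> p * q \<in> I"
  using ideal_mult_left by (simp add: mult.commute)

lemma ideal_zero: "0 \<in> I"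
  using additive_subgroup.zero_closed[OF ideal.axioms(1)[OF ideal]] by (simp add: ring_of_type_algebra_def)

lemma ideal_uminus: "p \<in> I \<Longrightarrow> - p \<in> I"
  using ideal_mult_left[of p "-1"] by simp

lemma supp_add: "m \<in> supp I \<Longrightarrow> m + d \<in> supp I"
  unfolding supp_def by (simp add: monomial_add ideal_mult_right)

text \<open>
  The polynomials all of whose monomials lie in \<open>supp I\<close> form an ideal that contains the monomial
  generators of \<open>I\<close>, so membership in \<open>I\<close> can be tested on each monomial separately.
\<close>

lemma mem_ideal_iff: "p \<in> I \<longleftrightarrow> keys p \<subseteq> supp I"
proof
  obtain M where I: "I = Idl\<^bsub>kS\<^esub> (monomial ` M)"
    using monomial_ideal unfolding monomial_ideal_def by blast
  have M: "M \<subseteq> supp I"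
    unfolding supp_def I
    using ring.genideal_self[OF ring_from_type_algebra, of "monomial ` M"]
    by (auto simp: ring_of_type_algebra_def)
  define J :: "('n, 'k) octant_algebra set" where "J = {p. keys p \<subseteq> supp I}"
  have J_mult: "x * p \<in> J" if "p \<in> J" for x p
  proof -
    have "keys (x * p) \<subseteq> {a + b | a b. a \<in> keys x \<and> b \<in> keys p}"
      by (rule keys_mult)
    also have "\<dots> \<subseteq> supp I"
      using that unfolding J_def by (auto, metis add.commute subsetD supp_add)
    finally show ?thesis
      unfolding J_def by simp
  qed
  have J_add: "p + q \<in> J" if "p \<in> J" "q \<in> J" for p q
    using that keys_add[of p q] unfolding J_def by auto
  have "ideal J kS"
  proof (rule idealI[OF ring_from_type_algebra])
    have group: "group (add_monoid (kS :: ('n, 'k) octant_algebra ring))"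
      by (rule abelian_group.a_group[OF ring.is_abelian_group[OF ring_from_type_algebra]])
    have "inv\<^bsub>add_monoid kS\<^esub> a = - a" for a :: "('n, 'k) octant_algebra"
      by (rule group.inv_equality[OF group]) (simp_all add: ring_of_type_algebra_def)
    moreover have "- a \<in> J" if "a \<in> J" for a
      using J_mult[OF that, of "-1"] by simp
    ultimately show "subgroup J (add_monoid kS)"
      using J_add
      by (intro group.subgroupI[OF group])
         (auto simp: ring_of_type_algebra_def J_def intro: exI[of _ 0])
  qed (use J_mult in \<open>auto simp: ring_of_type_algebra_def mult.commute\<close>)
  moreover have "monomial ` M \<subseteq> J"
    using M unfolding J_def by auto
  ultimately have "I \<subseteq> J"
    unfolding I by (intro ring.genideal_minimal[OF ring_from_type_algebra]) auto
  then show "p \<in> I \<Longrightarrow> keys p \<subseteq> supp I"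
    unfolding J_def by blast
next
  assume sub: "keys p \<subseteq> supp I"
  have "(\<Sum>m\<in>A. Poly_Mapping.single m (lookup p m)) \<in> I" if "finite A" "A \<subseteq> keys p" for A
    using that
  proof (induction A)
    case (insert m A)
    then have "monomial m \<in> I"
      using sub unfolding supp_def by auto
    then have "Poly_Mapping.single m (lookup p m) \<in> I"
      by (subst single_eq_cst_mult) (rule ideal_mult_left)
    then show ?case
      using insert by (auto intro: ideal_add)
  qed (auto intro: ideal_zero)
  from this[of "keys p"] show "p \<in> I"
    by (subst poly_mapping_eq_sum_single) simp
qed

lemma lookup_eq_0_if_mem_ideal: "p \<in> I \<Longrightarrow> m \<notin> supp I \<Longrightarrow> lookup p m = 0"
  using mem_ideal_iff by (metis in_keys_iff subsetD)

lemma std_basis_notin_supp: "std_basis i \<notin> supp I"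
  using full unfolding full_def by blast

lemma zero_notin_supp: "0 \<notin> supp I"
  using std_basis_notin_supp[of undefined] supp_add[of 0 "std_basis undefined"] by auto

definition cong :: "('n, 'k) octant_algebra \<Rightarrow> ('n, 'k) octant_algebra \<Rightarrow> bool" (infix \<open>\<equiv>\<^sub>I\<close> 50)
  where "p \<equiv>\<^sub>I q \<longleftrightarrow> p - q \<in> I"

lemma cong_refl [simp]: "p \<equiv>\<^sub>I p"
  unfolding cong_def by (simp add: ideal_zero)

lemma cong_sym: "p \<equiv>\<^sub>I q \<Longrightarrow> q \<equiv>\<^sub>I p"
  unfolding cong_def using ideal_uminus by fastforce

lemma cong_trans [trans]: "p \<equiv>\<^sub>I q \<Longrightarrow> q \<equiv>\<^sub>I r \<Longrightarrow> p \<equiv>\<^sub>I r"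
  unfolding cong_def using ideal_add[of "p - q" "q - r"] by simp

lemma cong_add: "p \<equiv>\<^sub>I q \<Longrightarrow> p' \<equiv>\<^sub>I q' \<Longrightarrow> p + p' \<equiv>\<^sub>I q + q'"
  unfolding cong_def using ideal_add[of "p - q" "p' - q'"] by (simp add: algebra_simps)

lemma cong_mult: "p \<equiv>\<^sub>I q \<Longrightarrow> p' \<equiv>\<^sub>I q' \<Longrightarrow> p * p' \<equiv>\<^sub>I q * q'"
  unfolding cong_def
  using ideal_add[OF ideal_mult_right[of "p - q" p'] ideal_mult_left[of "p' - q'" q]]
  by (simp add: algebra_simps)

text \<open>
  The coefficients outside \<open>supp I\<close> are therefore well-defined on the quotient. By fullness they
  include the constant and the linear ones.
\<close>

lemma cong_lookup: "p \<equiv>\<^sub>I q \<Longrightarrow> m \<notin> supp I \<Longrightarrow> lookup p m = lookup q m"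
  unfolding cong_def by (drule (1) lookup_eq_0_if_mem_ideal) (simp add: lookup_minus)

lemma residue_eq_iff: "residue I p = residue I q \<longleftrightarrow> p \<equiv>\<^sub>I q"
proof -
  interpret abelian_subgroup I kS by (rule abelian_subgroup)
  have "p \<in> residue I q \<longleftrightarrow> p - q \<in> I"
    unfolding a_r_coset_def' by (force simp: ring_of_type_algebra_def)
  then show ?thesis
    unfolding cong_def using a_repr_independence'[of p q] a_rcos_self[of p]
    by (auto simp: ring_of_type_algebra_def)
qed

lemma carrier_quot: "carrier (quot_alg I) = range (residue I)"
  unfolding FactRing_def A_RCOSETS_def' by (auto simp: ring_of_type_algebra_def)

lemma residue_carrier [simp]: "residue I p \<in> carrier (quot_alg I)"
  by (simp add: carrier_quot)

lemma residue_add: "residue I p \<oplus>\<^bsub>quot_alg I\<^esub> residue I q = residue I (p + q)"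
  using abelian_subgroup.a_rcos_sum[OF abelian_subgroup, of p q]
  by (simp add: FactRing_def ring_of_type_algebra_def)

lemma residue_mult: "residue I p \<otimes>\<^bsub>quot_alg I\<^esub> residue I q = residue I (p * q)"
  using ideal.rcoset_mult_add[OF ideal, of p q]
  by (simp add: FactRing_def ring_of_type_algebra_def)

lemma residue_one: "\<one>\<^bsub>quot_alg I\<^esub> = residue I 1"
  by (simp add: FactRing_def ring_of_type_algebra_def)

section \<open>Automorphisms and their linear parts\<close>

text \<open>
  A set-theoretic lift of \<open>f\<close> to polynomials. It is an algebra homomorphism only modulo \<open>I\<close>, which
  suffices since only coefficients outside \<open>supp I\<close> are ever read off.
\<close>

definition lift :: "(('n, 'k) octant_algebra set \<Rightarrow> ('n, 'k) octant_algebra set)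
    \<Rightarrow> ('n, 'k) octant_algebra \<Rightarrow> ('n, 'k) octant_algebra" where
  "lift f p = (SOME q. f (residue I p) = residue I q)"

lemma alg_auto_residue:
  assumes "f \<in> alg_auto I"
  shows "f (residue I p) = residue I (lift f p)"
proof -
  have "f (residue I p) \<in> carrier (quot_alg I)"
    using assms unfolding alg_auto_def by (auto simp: ring_hom_def)
  then have "\<exists>q. f (residue I p) = residue I q"
    unfolding carrier_quot by blast
  then show ?thesis
    unfolding lift_def by (rule someI_ex)
qed

lemma lift_cong: "f \<in> alg_auto I \<Longrightarrow> p \<equiv>\<^sub>I q \<Longrightarrow> lift f p \<equiv>\<^sub>I lift f q"
  using alg_auto_residue[of f p] alg_auto_residue[of f q] unfolding residue_eq_iff[symmetric] by simp

lemma lift_add: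
  assumes "f \<in> alg_auto I"
  shows "lift f (p + q) \<equiv>\<^sub>I lift f p + lift f q"
proof -
  have "f (residue I p \<oplus>\<^bsub>quot_alg I\<^esub> residue I q) = f (residue I p) \<oplus>\<^bsub>quot_alg I\<^esub> f (residue I q)"
    using assms unfolding alg_auto_def ring_hom_def by auto
  then show ?thesis
    by (simp add: residue_add alg_auto_residue[OF assms] residue_eq_iff)
qed

lemma lift_mult:
  assumes "f \<in> alg_auto I"
  shows "lift f (p * q) \<equiv>\<^sub>I lift f p * lift f q"
proof -
  have "f (residue I p \<otimes>\<^bsub>quot_alg I\<^esub> residue I q) = f (residue I p) \<otimes>\<^bsub>quot_alg I\<^esub> f (residue I q)"
    using assms unfolding alg_auto_def ring_hom_def by auto
  then show ?thesis
    by (simp add: residue_mult alg_auto_residue[OF assms] residue_eq_iff)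
qed

lemma lift_cst:
  assumes "f \<in> alg_auto I"
  shows "lift f (cst c) \<equiv>\<^sub>I cst c"
proof -
  have "f (scalar I c) = scalar I c"
    using assms unfolding alg_auto_def by auto
  then show ?thesis
    by (simp add: scalar_def alg_auto_residue[OF assms] residue_eq_iff)
qed

lemma lift_inverse:
  assumes "f \<in> alg_auto I" "g \<in> alg_auto I" and "\<And>a. a \<in> carrier (quot_alg I) \<Longrightarrow> g (f a) = a"
  shows "lift g (lift f p) \<equiv>\<^sub>I p"
  using assms(3)[of "residue I p"]
  by (simp add: alg_auto_residue[OF assms(1)] alg_auto_residue[OF assms(2)] residue_eq_iff)

lemma alg_auto_inverse:
  assumes "f \<in> alg_auto I"
  obtains g where "g \<in> alg_auto I"
    and "\<And>a. a \<in> carrier (quot_alg I) \<Longrightarrow> g (f a) = a"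
    and "\<And>a. a \<in> carrier (quot_alg I) \<Longrightarrow> f (g a) = a"
proof
  let ?A = "carrier (quot_alg I)"
  let ?g = "restrict (inv_into ?A f) ?A"
  have f: "f \<in> ring_hom (quot_alg I) (quot_alg I)" "bij_betw f ?A ?A"
      "\<And>c. f (scalar I c) = scalar I c"
    using assms unfolding alg_auto_def Bij_def by auto
  then have "f \<in> ring_iso (quot_alg I) (quot_alg I)"
    unfolding ring_iso_def by auto
  then have "inv_into ?A f \<in> ring_iso (quot_alg I) (quot_alg I)"
    by (rule ring_iso_set_sym[OF ideal.quotient_is_ring[OF ideal]])
  then have inv: "inv_into ?A f \<in> ring_hom (quot_alg I) (quot_alg I)" "bij_betw (inv_into ?A f) ?A ?A"
    unfolding ring_iso_def by auto
  show gf: "?g (f a) = a" if "a \<in> ?A" for a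
    using f that by (simp add: bij_betw_inv_into_left bij_betw_apply)
  show "f (?g a) = a" if "a \<in> ?A" for a
    using f that by (simp add: bij_betw_inv_into_right)
  have "?g (scalar I c) = scalar I c" for c
    using gf[of "scalar I c"] f(3) by (simp add: scalar_def)
  moreover have "?g \<in> ring_hom (quot_alg I) (quot_alg I)"
    using ring.ring_hom_restrict[OF ideal.quotient_is_ring[OF ideal] inv(1)] by simp
  moreover have "?g \<in> Bij ?A"
    using inv(2) unfolding Bij_def by auto
  ultimately show "?g \<in> alg_auto I"
    unfolding alg_auto_def by blast
qed

definition coeff_at :: "'n octant \<Rightarrow> ('n, 'k) octant_algebra set \<Rightarrow> 'k" where
  "coeff_at m a = lookup (SOME p. a = residue I p) m"

lemma coeff_at_residue: "m \<notin> supp I \<Longrightarrow> coeff_at m (residue I p) = lookup p m"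
  unfolding coeff_at_def
  by (rule cong_lookup[symmetric]) (metis (mono_tags) residue_eq_iff someI)

lemma linear_functional_coeff_at:
  assumes "m \<notin> supp I"
  shows "linear_functional I (coeff_at m)"
  using lookup_single_mult[of 0 _ _ m] assms
  unfolding linear_functional_def carrier_quot scalar_def
  by (auto simp: residue_add residue_mult coeff_at_residue lookup_add)

text \<open>
  The matrix of \<open>f\<close> on the cotangent space at the origin, in the basis of the variables.
\<close>

definition linear_part :: "(('n, 'k) octant_algebra set \<Rightarrow> ('n, 'k) octant_algebra set)
    \<Rightarrow> 'n \<Rightarrow> 'n \<Rightarrow> 'k" where
  "linear_part f i j = coeff_at (std_basis j) (f (residue I (var i)))"

lemma linear_part_eq:
  "f \<in> alg_auto I \<Longrightarrow> linear_part f i j = lookup (lift f (var i)) (std_basis j)"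
  unfolding linear_part_def
  by (simp add: alg_auto_residue coeff_at_residue std_basis_notin_supp)

lemma monomial_single_eq_power:
  "monomial (Poly_Mapping.single i N) = (var i ^ N :: ('n, 'k) octant_algebra)"
proof (induction N)
  case (Suc N)
  have "monomial (Poly_Mapping.single i (Suc N)) = var i * (monomial (Poly_Mapping.single i N) :: ('n, 'k) octant_algebra)"
    by (simp add: mult_single plus_1_eq_Suc flip: single_add)
  then show ?case
    by (simp add: Suc)
qed simp

lemma var_nilpotent:
  obtains N where "(var i :: ('n, 'k) octant_algebra) ^ N \<in> I"
proof -
  have "inj (\<lambda>N. Poly_Mapping.single i N :: 'n octant)"
    by simp
  then have "infinite (range (\<lambda>N. Poly_Mapping.single i N :: 'n octant))"
    using finite_imageD by blast
  then have "\<not> range (\<lambda>N. Poly_Mapping.single i N :: 'n octant) \<subseteq> UNIV - supp I"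
    using cofinite_support finite_subset unfolding cofinite_support_def by blast
  then obtain N where "Poly_Mapping.single i N \<in> supp I"
    by auto
  then show ?thesis
    using that[of N] unfolding supp_def by (simp flip: monomial_single_eq_power)
qed

lemma lift_power:
  assumes "f \<in> alg_auto I"
  shows "lift f (p ^ N) \<equiv>\<^sub>I lift f p ^ N"
proof (induction N)
  case 0
  show ?case
    using lift_cst[OF assms, of 1] by simp
next
  case (Suc N)
  then show ?case
    using cong_trans[OF lift_mult[OF assms, of p "p ^ N"] cong_mult[OF cong_refl Suc]] by simp
qed

text \<open>
  Some power of each variable lies in \<open>I\<close>, because \<open>supp I\<close> is cofinite. An automorphism maps the
  nilpotent class of \<open>x\<^sub>i\<close> to a nilpotent class, and a nilpotent class has constant term zero.
\<close>

lemma lookup_lift_var_0: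
  assumes "f \<in> alg_auto I"
  shows "lookup (lift f (var i)) 0 = 0"
proof -
  obtain N where "(var i :: ('n, 'k) octant_algebra) ^ N \<in> I"
    by (rule var_nilpotent)
  then have N: "var i ^ N \<equiv>\<^sub>I cst 0"
    by (simp add: cong_def)
  have "lift f (var i) ^ N \<equiv>\<^sub>I lift f (var i ^ N)"
    by (rule cong_sym[OF lift_power[OF assms]])
  also have "\<dots> \<equiv>\<^sub>I lift f (cst 0)"
    by (rule lift_cong[OF assms N])
  also have "\<dots> \<equiv>\<^sub>I cst 0"
    by (rule lift_cst[OF assms])
  finally have "lift f (var i) ^ N \<equiv>\<^sub>I cst 0" .
  from cong_lookup[OF this zero_notin_supp] have "lookup (lift f (var i) ^ N) 0 = 0"
    by simp
  moreover have "lookup (q ^ N) 0 = lookup q 0 ^ N" for q :: "('n, 'k) octant_algebra"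
    by (induction N) (simp_all add: lookup_mult_0)
  ultimately show ?thesis
    by (metis power_not_zero)
qed

lemma lift_single_step:
  assumes "f \<in> alg_auto I"
  shows "lift f (Poly_Mapping.single (std_basis i + m) c) \<equiv>\<^sub>I
    lift f (var i) * lift f (Poly_Mapping.single m c)"
  using lift_mult[OF assms, of "var i" "Poly_Mapping.single m c"] by (simp add: mult_single)

lemma lookup_lift_0:
  assumes "f \<in> alg_auto I"
  shows "lookup (lift f p) 0 = lookup p 0"
proof (induction p rule: poly_mapping_additive_induct)
  case zero
  show ?case
    using cong_lookup[OF lift_cst[OF assms, of 0] zero_notin_supp] by simp
next
  case (add p q)
  then show ?case
    using cong_lookup[OF lift_add[OF assms, of p q] zero_notin_supp] by (simp add: lookup_add)
next
  case (single m c)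
  show ?case
  proof (cases "m = 0")
    case True
    then show ?thesis
      using cong_lookup[OF lift_cst[OF assms, of c] zero_notin_supp] by simp
  next
    case False
    then obtain i m' where m: "m = std_basis i + m'"
      by (rule octant_nonzero_split)
    show ?thesis
      using cong_lookup[OF lift_single_step[OF assms, of i m' c] zero_notin_supp] False
      by (simp add: m lookup_mult_0 lookup_lift_var_0[OF assms] lookup_single)
  qed
qed

text \<open>
  The linear part of \<open>f\<close> determines its action on linear coefficients: a monomial of degree at
  least two is a product of two factors without constant term, and so is its image, which has no
  linear coefficients.
\<close>

lemma lookup_lift_std_basis:
  assumes "f \<in> alg_auto I"
  shows "lookup (lift f p) (std_basis j) = (\<Sum>k\<in>UNIV. lookup p (std_basis k) * linear_part f k j)"
proof (induction p rule: poly_mapping_additive_induct)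
  case zero
  show ?case
    using cong_lookup[OF lift_cst[OF assms, of 0] std_basis_notin_supp] by simp
next
  case (add p q)
  then show ?case
    using cong_lookup[OF lift_add[OF assms, of p q] std_basis_notin_supp[of j]]
    by (simp add: lookup_add sum.distrib distrib_right)
next
  case (single m c)
  show ?case
  proof (cases "m = 0")
    case True
    then show ?thesis
      using cong_lookup[OF lift_cst[OF assms, of c] std_basis_notin_supp[of j]]
      by (simp add: lookup_single_not_eq)
  next
    case False
    then obtain i m' where m: "m = std_basis i + m'"
      by (rule octant_nonzero_split)
    have "std_basis i + m' = std_basis k \<longleftrightarrow> m' = 0 \<and> i = k" for k
      using add_eq_std_basis_iff[of "std_basis i" m' k] by auto
    then have "(\<Sum>k\<in>UNIV. lookup (Poly_Mapping.single m c) (std_basis k) * linear_part f k j)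
        = (\<Sum>k\<in>UNIV. if i = k then (c when m' = 0) * linear_part f k j else 0)"
      by (intro sum.cong) (auto simp: m lookup_single when_def)
    then show ?thesis
      using cong_lookup[OF lift_single_step[OF assms, of i m' c] std_basis_notin_supp[of j]]
      by (simp add: m lookup_mult_std_basis lookup_lift_var_0[OF assms] lookup_lift_0[OF assms]
          linear_part_eq[OF assms] lookup_single mult.commute)
  qed
qed

lemma linear_part_inverse:
  assumes f: "f \<in> alg_auto I" and g: "g \<in> alg_auto I"
    and gf: "\<And>a. a \<in> carrier (quot_alg I) \<Longrightarrow> g (f a) = a"
  shows "(\<Sum>k\<in>UNIV. linear_part f i k * linear_part g k j) = (if i = j then 1 else 0)"
proof -
  have "(\<Sum>k\<in>UNIV. linear_part f i k * linear_part g k j) = lookup (lift g (lift f (var i))) (std_basis j)"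
    by (simp add: lookup_lift_std_basis[OF g] linear_part_eq[OF f])
  also have "\<dots> = lookup (var i) (std_basis j)"
    by (rule cong_lookup[OF lift_inverse[OF f g gf] std_basis_notin_supp])
  also have "\<dots> = (if i = j then 1 else 0)"
    by (auto simp: lookup_single when_def)
  finally show ?thesis .
qed

text \<open>
  The linear part is invertible, so some term in the Leibniz expansion of its determinant is
  nonzero.
\<close>

lemma linear_part_matching:
  assumes "f \<in> alg_auto I"
  obtains \<pi> where "\<pi> permutes UNIV" and "\<And>i. linear_part f i (\<pi> i) \<noteq> 0"
proof -
  obtain g where g: "g \<in> alg_auto I" "\<And>a. a \<in> carrier (quot_alg I) \<Longrightarrow> g (f a) = a"
    using alg_auto_inverse[OF assms] by metis
  let ?A = "\<chi> i j. linear_part f i j" and ?B = "\<chi> i j. linear_part g i j"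
  have "?A ** ?B = mat 1"
    unfolding matrix_matrix_mult_def mat_def
    by (simp add: vec_eq_iff linear_part_inverse[OF assms g])
  then have "det ?A \<noteq> 0"
    by (metis det_I det_mul mult_zero_left zero_neq_one)
  then obtain \<pi> where "\<pi> permutes UNIV"
      and "of_int (sign \<pi>) * (\<Prod>i\<in>UNIV. ?A $ i $ \<pi> i) \<noteq> 0"
    unfolding det_def by (metis (no_types, lifting) mem_Collect_eq sum.neutral)
  then show ?thesis
    using that by simp
qed

section \<open>Replaceable variables and derivations\<close>

definition replaceable :: "'n \<Rightarrow> 'n \<Rightarrow> bool" where
  "replaceable i j \<longleftrightarrow> (\<forall>m. std_basis i + m \<in> supp I \<longrightarrow> std_basis j + m \<in> supp I)"

lemma replaceable_refl: "replaceable i i"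
  unfolding replaceable_def by blast

lemma replaceable_trans [trans]: "replaceable i j \<Longrightarrow> replaceable j k \<Longrightarrow> replaceable i k"
  unfolding replaceable_def by blast

text \<open>
  The set of all \<open>j\<close> with \<open>\<pi> i \<rightarrow> j\<close> is mapped into itself by the injection \<open>\<pi>\<close>, so \<open>\<pi>\<close> permutes it.
  It contains \<open>\<pi> i\<close>, hence also the preimage \<open>i\<close>.
\<close>

lemma replaceable_permutation_sym:
  assumes "bij \<pi>" and "\<And>i. replaceable i (\<pi> i)"
  shows "replaceable (\<pi> i) i"
proof -
  let ?U = "{j. replaceable (\<pi> i) j}"
  have "\<pi> ` ?U = ?U"
  proof (rule endo_inj_surj)
    show "\<pi> ` ?U \<subseteq> ?U"
      using assms(2) replaceable_trans by blast
    show "inj_on \<pi> ?U"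
      using assms(1) bij_is_inj inj_on_subset by blast
  qed simp
  then obtain j where "j \<in> ?U" "\<pi> i = \<pi> j"
    using replaceable_refl by blast
  then show ?thesis
    using assms(1) by (auto dest: bij_is_inj injD)
qed

definition leibniz_mod :: "(('n, 'k) octant_algebra \<Rightarrow> ('n, 'k) octant_algebra) \<Rightarrow> bool" where
  "leibniz_mod D \<longleftrightarrow> (\<forall>p q. p \<equiv>\<^sub>I q \<longrightarrow> D p \<equiv>\<^sub>I D q) \<and>
     (\<forall>p q. D (p * q) \<equiv>\<^sub>I D p * q + p * D q)"

lemma leibniz_mod_mem:
  assumes "leibniz_mod D" and "p \<in> I"
  shows "D p \<in> I"
proof -
  have "D p \<equiv>\<^sub>I D (0 * 0)"
    using assms unfolding leibniz_mod_def by (auto simp: cong_def)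
  moreover have "D (0 * 0) \<equiv>\<^sub>I D 0 * 0 + 0 * D 0"
    using assms(1) unfolding leibniz_mod_def by blast
  ultimately have "D p \<equiv>\<^sub>I 0"
    using cong_trans by fastforce
  then show ?thesis
    by (simp add: cong_def)
qed

lemma leibniz_mod_power:
  assumes "leibniz_mod D"
  shows "D (monomial (Poly_Mapping.single i (Suc r))) \<equiv>\<^sub>I
    Poly_Mapping.single (Poly_Mapping.single i r) (of_nat (Suc r)) * D (var i)"
proof (induction r)
  case 0
  show ?case
    by (simp flip: One_nat_def)
next
  case (Suc r)
  let ?m = "\<lambda>r. monomial (Poly_Mapping.single i r) :: ('n, 'k) octant_algebra"
  have eq: "?m (Suc (Suc r)) = var i * ?m (Suc r)"
    by (simp add: mult_single plus_1_eq_Suc flip: single_add)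
  have "D (var i * ?m (Suc r)) \<equiv>\<^sub>I D (var i) * ?m (Suc r) + var i * D (?m (Suc r))"
    using assms unfolding leibniz_mod_def by blast
  also have "\<dots> \<equiv>\<^sub>I D (var i) * ?m (Suc r) +
      var i * (Poly_Mapping.single (Poly_Mapping.single i r) (of_nat (Suc r)) * D (var i))"
    by (intro cong_add cong_mult cong_refl Suc)
  also have "\<dots> = D (var i) * ?m (Suc r) +
      Poly_Mapping.single (Poly_Mapping.single i (Suc r)) (of_nat (Suc r)) * D (var i)"
    by (simp add: mult_single plus_1_eq_Suc flip: single_add mult.assoc)
  also have "\<dots> = (?m (Suc r) + Poly_Mapping.single (Poly_Mapping.single i (Suc r)) (of_nat (Suc r))) * D (var i)"
    by (simp add: algebra_simps)
  also have "\<dots> = Poly_Mapping.single (Poly_Mapping.single i (Suc r)) (of_nat (Suc (Suc r))) * D (var i)"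
    by (subst single_add[symmetric]) simp
  finally show ?case
    unfolding eq .
qed

text \<open>
  Let \<open>i \<noteq> j\<close>, let \<open>d\<close> be the coefficient of \<open>x\<^sub>j\<close> in \<open>D x\<^sub>i\<close>, and let \<open>x\<^sub>i x\<^sup>m\<close> be a monomial of \<open>I\<close>.
  Its image under \<open>D\<close> lies in \<open>I\<close>. If \<open>r\<close> is the exponent of \<open>x\<^sub>i\<close> in \<open>x\<^sup>m\<close>, then the coefficient of \<open>x\<^sub>j x\<^sup>m\<close> in this
  image is \<open>(r + 1) d\<close>: a contribution to this monomial, whose degree in \<open>x\<^sub>i\<close> is only \<open>r\<close>, must come
  from differentiating one of the \<open>r + 1\<close> factors \<open>x\<^sub>i\<close>. In characteristic zero the coefficient is
  nonzero, so \<open>x\<^sub>j x\<^sup>m\<close> lies in \<open>I\<close>.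
\<close>

lemma leibniz_mod_replaceable:
  assumes D: "leibniz_mod D" and nz: "lookup (D (var i)) (std_basis j) \<noteq> 0"
  shows "replaceable i j"
proof (cases "i = j")
  case False
  show ?thesis
    unfolding replaceable_def
  proof (intro allI impI, rule ccontr)
    fix m assume m: "std_basis i + m \<in> supp I" and notin: "std_basis j + m \<notin> supp I"
    define r where "r = lookup m i"
    define m' where "m' = m - Poly_Mapping.single i r"
    have m_eq: "m = Poly_Mapping.single i r + m'"
      unfolding m'_def r_def
      by (intro poly_mapping_eqI) (auto simp: lookup_add lookup_minus lookup_single when_def)
    let ?x = "monomial (Poly_Mapping.single i (Suc r)) :: ('n, 'k) octant_algebra"
    let ?y = "monomial m' :: ('n, 'k) octant_algebra"
    have "std_basis i + m = Poly_Mapping.single i (Suc r) + m'"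
      unfolding m_eq by (simp add: add.assoc[symmetric] plus_1_eq_Suc flip: single_add)
    then have "?x * ?y \<in> I"
      using m unfolding supp_def by (simp add: mult_single)
    then have "D (?x * ?y) \<in> I"
      by (rule leibniz_mod_mem[OF D])
    moreover have "D (?x * ?y) \<equiv>\<^sub>I D ?x * ?y + ?x * D ?y"
      using D unfolding leibniz_mod_def by blast
    moreover have "D ?x * ?y + ?x * D ?y \<equiv>\<^sub>I
        (Poly_Mapping.single (Poly_Mapping.single i r) (of_nat (Suc r)) * D (var i)) * ?y + ?x * D ?y"
      by (intro cong_add cong_mult cong_refl leibniz_mod_power[OF D])
    ultimately have "(Poly_Mapping.single (Poly_Mapping.single i r) (of_nat (Suc r)) * D (var i)) * ?y
        + ?x * D ?y \<equiv>\<^sub>I D (?x * ?y)" and mem: "D (?x * ?y) \<in> I"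
      using cong_sym[OF cong_trans] by blast+
    from cong_lookup[OF this(1) notin] lookup_eq_0_if_mem_ideal[OF mem notin]
    have "lookup ((Poly_Mapping.single (Poly_Mapping.single i r) (of_nat (Suc r)) * D (var i)) * ?y
        + ?x * D ?y) (std_basis j + m) = 0"
      by simp
    moreover have "(Poly_Mapping.single (Poly_Mapping.single i r) (of_nat (Suc r)) * D (var i)) * ?y
        = Poly_Mapping.single m (of_nat (Suc r)) * D (var i)"
    proof -
      have "Poly_Mapping.single m (of_nat (Suc r)) = Poly_Mapping.single (Poly_Mapping.single i r) (of_nat (Suc r)) * ?y"
        unfolding m_eq by (simp add: mult_single)
      then show ?thesis
        by (simp only: mult.assoc mult.commute[of ?y])
    qed
    moreover have "lookup (?x * D ?y) (std_basis j + m) = 0"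
    proof (rule lookup_single_mult_eq_0)
      fix b
      show "std_basis j + m \<noteq> Poly_Mapping.single i (Suc r) + b"
      proof
        assume "std_basis j + m = Poly_Mapping.single i (Suc r) + b"
        then have "lookup (std_basis j + m) i = lookup (Poly_Mapping.single i (Suc r) + b) i"
          by simp
        then show False
          using False by (simp add: lookup_add lookup_single_not_eq r_def)
      qed
    qed
    ultimately have "of_nat (Suc r) * lookup (D (var i)) (std_basis j) = 0"
      using lookup_single_mult[of m "of_nat (Suc r)" "D (var i)" "std_basis j"]
      by (simp add: lookup_add add.commute)
    then show False
      using nz by (simp del: of_nat_Suc)
  qed
qed (simp add: replaceable_refl)

text \<open>
  The derivation \<open>x\<^sub>k \<partial>/\<partial>x\<^sub>k\<close>. It multiplies each monomial by a scalar, so it preserves every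
  monomial ideal.
\<close>

definition euler :: "'n \<Rightarrow> ('n, 'k) octant_algebra \<Rightarrow> ('n, 'k) octant_algebra" where
  "euler k = Poly_Mapping.mapp (\<lambda>m c. of_nat (lookup m k) * c)"

lemma lookup_euler: "lookup (euler k p) m = of_nat (lookup m k) * lookup p m"
  unfolding euler_def by (simp add: lookup_mapp when_def in_keys_iff)

lemma euler_add: "euler k (p + q) = euler k p + euler k q"
  by (intro poly_mapping_eqI) (simp add: lookup_euler lookup_add algebra_simps)

lemma euler_single: "euler k (Poly_Mapping.single m c) = Poly_Mapping.single m (of_nat (lookup m k) * c)"
  by (intro poly_mapping_eqI) (simp add: lookup_euler lookup_single when_def)

lemma euler_mult: "euler k (p * q) = euler k p * q + p * euler k q"
proof (induction p rule: poly_mapping_additive_induct)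
  case zero
  have "euler k 0 = 0"
    using euler_single[of k 0 0] by simp
  then show ?case by simp
next
  case (single m c)
  show ?case
  proof (induction q rule: poly_mapping_additive_induct)
    case zero
    have "euler k 0 = 0"
      using euler_single[of k 0 0] by simp
    then show ?case by simp
  next
    case (single m' c')
    show ?case
      by (simp add: mult_single euler_single lookup_add algebra_simps flip: single_add)
  qed (simp add: euler_add algebra_simps)
qed (simp add: euler_add algebra_simps)

lemma euler_cong:
  assumes "p \<equiv>\<^sub>I q"
  shows "euler k p \<equiv>\<^sub>I euler k q"
proof -
  have "euler k p - euler k q = euler k (p - q)"
    by (intro poly_mapping_eqI) (simp add: lookup_euler lookup_minus algebra_simps)
  moreover have "keys (euler k (p - q)) \<subseteq> keys (p - q)"
    by (auto simp: in_keys_iff lookup_euler)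
  ultimately show ?thesis
    using assms unfolding cong_def mem_ideal_iff by auto
qed

lemma leibniz_mod_conjugate_euler:
  assumes f: "f \<in> alg_auto I" and g: "g \<in> alg_auto I"
    and gf: "\<And>a. a \<in> carrier (quot_alg I) \<Longrightarrow> g (f a) = a"
  shows "leibniz_mod (\<lambda>p. lift g (euler k (lift f p)))"
  unfolding leibniz_mod_def
proof (intro conjI allI impI)
  fix p q
  show "lift g (euler k (lift f p)) \<equiv>\<^sub>I lift g (euler k (lift f q))" if "p \<equiv>\<^sub>I q"
    by (intro lift_cong f g euler_cong that)
  let ?E = "\<lambda>p. euler k (lift f p)"
  have "euler k (lift f (p * q)) \<equiv>\<^sub>I ?E p * lift f q + lift f p * ?E q"
    unfolding euler_mult[symmetric] by (intro euler_cong lift_mult f)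
  then have "lift g (?E (p * q)) \<equiv>\<^sub>I lift g (?E p * lift f q + lift f p * ?E q)"
    by (rule lift_cong[OF g])
  also have "\<dots> \<equiv>\<^sub>I lift g (?E p * lift f q) + lift g (lift f p * ?E q)"
    by (rule lift_add[OF g])
  also have "\<dots> \<equiv>\<^sub>I lift g (?E p) * lift g (lift f q) + lift g (lift f p) * lift g (?E q)"
    by (intro cong_add lift_mult g)
  also have "\<dots> \<equiv>\<^sub>I lift g (?E p) * q + p * lift g (?E q)"
    by (intro cong_add cong_mult cong_refl lift_inverse f g gf)
  finally show "lift g (?E (p * q)) \<equiv>\<^sub>I lift g (?E p) * q + p * lift g (?E q)" .
qed

text \<open>
  The conjugate of \<open>x\<^sub>k \<partial>/\<partial>x\<^sub>k\<close> under \<open>f\<close> maps \<open>x\<^sub>i\<close> to an element whose coefficient at \<open>x\<^sub>j\<close> is the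
  product of the two given entries.
\<close>

lemma linear_part_inverse_replaceable:
  assumes f: "f \<in> alg_auto I" and g: "g \<in> alg_auto I"
    and gf: "\<And>a. a \<in> carrier (quot_alg I) \<Longrightarrow> g (f a) = a"
    and "linear_part f i k \<noteq> 0" "linear_part g k j \<noteq> 0"
  shows "replaceable i j"
proof (rule leibniz_mod_replaceable[OF leibniz_mod_conjugate_euler[OF f g gf]])
  have "lookup (lift g (euler k (lift f (var i)))) (std_basis j)
      = (\<Sum>l\<in>UNIV. of_nat (lookup (std_basis l) k) * linear_part f i l * linear_part g l j)"
    by (simp add: lookup_lift_std_basis[OF g] lookup_euler linear_part_eq[OF f])
  also have "\<dots> = (\<Sum>l\<in>UNIV. if l = k then linear_part f i k * linear_part g k j else 0)"
    by (intro sum.cong) (auto simp: lookup_single when_def)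
  finally show "lookup (lift g (euler k (lift f (var i)))) (std_basis j) \<noteq> 0"
    using assms(4,5) by simp
qed

section \<open>Automorphisms that respect replaceability\<close>

definition respects_replaceable ::
    "(('n, 'k) octant_algebra set \<Rightarrow> ('n, 'k) octant_algebra set) \<Rightarrow> bool" where
  "respects_replaceable f \<longleftrightarrow> (\<forall>i k. linear_part f i k \<noteq> 0 \<longrightarrow> replaceable i k)"

text \<open>
  The left-hand side is a closed condition on \<open>f\<close>, the right-hand side an open one. From left to
  right, a nonzero term in the determinant provides the matching. From right to left, a matching for
  \<open>f\<close> with \<open>i \<rightarrow> \<pi> i\<close> shows first that the inverse of \<open>f\<close> respects replaceability; this gives a
  matching for the inverse, and the same argument then applies to \<open>f\<close>.
\<close>

lemma respects_replaceable_iff_matching: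
  assumes "f \<in> alg_auto I"
  shows "respects_replaceable f \<longleftrightarrow>
    (\<exists>\<pi>. \<pi> permutes UNIV \<and> (\<forall>i. replaceable i (\<pi> i)) \<and> (\<forall>i. linear_part f i (\<pi> i) \<noteq> 0))"
proof -
  let ?M = "\<lambda>f. \<exists>\<pi>. \<pi> permutes UNIV \<and> (\<forall>i. replaceable i (\<pi> i)) \<and> (\<forall>i. linear_part f i (\<pi> i) \<noteq> 0)"
  have matching: "?M f" if "f \<in> alg_auto I" "respects_replaceable f" for f
    using linear_part_matching[OF that(1)] that(2) unfolding respects_replaceable_def by metis
  have inverse: "respects_replaceable f"
    if f: "f \<in> alg_auto I" and g: "g \<in> alg_auto I"
      and gf: "\<And>a. a \<in> carrier (quot_alg I) \<Longrightarrow> g (f a) = a"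
      and M: "?M g" for f g
    unfolding respects_replaceable_def
  proof (intro allI impI)
    fix i k assume nz: "linear_part f i k \<noteq> 0"
    obtain \<pi> where \<pi>: "\<pi> permutes UNIV" "\<And>i. replaceable i (\<pi> i)" "\<And>i. linear_part g i (\<pi> i) \<noteq> 0"
      using M by blast
    \<comment> \<open>An entry of \<open>f\<close> at \<open>(i, k)\<close> can be combined with the entry of \<open>g\<close> at \<open>(k, \<pi> k)\<close>.\<close>
    have "replaceable i (\<pi> k)"
      using linear_part_inverse_replaceable[OF f g gf nz \<pi>(3)] .
    also have "replaceable (\<pi> k) k"
      using replaceable_permutation_sym[OF permutes_bij[OF \<pi>(1)] \<pi>(2)] .
    finally show "replaceable i k" .
  qed
  obtain g where g: "g \<in> alg_auto I" "\<And>a. a \<in> carrier (quot_alg I) \<Longrightarrow> g (f a) = a"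
      "\<And>a. a \<in> carrier (quot_alg I) \<Longrightarrow> f (g a) = a"
    using alg_auto_inverse[OF assms] by metis
  show ?thesis
    using matching[OF assms] inverse[OF assms g(1,2)] inverse[OF g(1) assms g(3)] matching[OF g(1)]
    by blast
qed

section \<open>The automorphism group with its Zariski topology\<close>

lemma carrier_Aut: "carrier (Aut I) = alg_auto I"
  unfolding Aut_def by simp

lemma alg_auto_closed: "f \<in> alg_auto I \<Longrightarrow> a \<in> carrier (quot_alg I) \<Longrightarrow> f a \<in> carrier (quot_alg I)"
  unfolding alg_auto_def by (auto simp: ring_hom_def)

text \<open>
  The classes of the variables generate the quotient as an algebra.
\<close>

lemma alg_auto_eqI:
  assumes f: "f \<in> alg_auto I" and g: "g \<in> alg_auto I"
    and eq: "\<And>i. f (residue I (var i)) = g (residue I (var i))"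
  shows "f = g"
proof -
  have var: "lift f (var i) \<equiv>\<^sub>I lift g (var i)" for i
    using eq by (simp add: alg_auto_residue f g residue_eq_iff)
  have cst: "lift f (cst c) \<equiv>\<^sub>I lift g (cst c)" for c
    by (rule cong_trans[OF lift_cst[OF f] cong_sym[OF lift_cst[OF g]]])
  have "lift f p \<equiv>\<^sub>I lift g p" for p
  proof (induction p rule: poly_mapping_additive_induct)
    case zero
    show ?case using cst[of 0] by simp
  next
    case (add p q)
    show ?case
      by (rule cong_trans[OF lift_add[OF f] cong_trans[OF cong_add[OF add] cong_sym[OF lift_add[OF g]]]])
  next
    case (single m c)
    show ?case
    proof (induction m rule: octant_induct)
      case (step i m)
      show ?case
        by (rule cong_trans[OF lift_single_step[OF f]
              cong_trans[OF cong_mult[OF var step] cong_sym[OF lift_single_step[OF g]]]])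
    qed (rule cst)
  qed
  then have "f a = g a" if "a \<in> carrier (quot_alg I)" for a
    using that alg_auto_residue[OF f] alg_auto_residue[OF g] unfolding carrier_quot residue_eq_iff[symmetric]
    by (metis imageE)
  then show ?thesis
    using f g unfolding alg_auto_def by (auto intro!: extensionalityI dest!: Bij_imp_extensional)
qed

lemma one_Aut_apply: "a \<in> carrier (quot_alg I) \<Longrightarrow> \<one>\<^bsub>Aut I\<^esub> a = a"
  unfolding Aut_def BijGroup_def by simp

lemma one_in_alg_auto: "\<one>\<^bsub>Aut I\<^esub> \<in> alg_auto I"
proof -
  interpret ring "quot_alg I"
    by (rule ideal.quotient_is_ring[OF ideal])
  show ?thesis
    using id_Bij unfolding alg_auto_def Aut_def BijGroup_def
    by (auto simp: ring_hom_def scalar_def)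
qed

lemma mult_Aut_apply:
  assumes "f \<in> alg_auto I" "g \<in> alg_auto I" "a \<in> carrier (quot_alg I)"
  shows "(f \<otimes>\<^bsub>Aut I\<^esub> g) a = f (g a)"
  using assms unfolding Aut_def BijGroup_def alg_auto_def by (simp add: compose_def)

lemma mult_in_alg_auto:
  assumes f: "f \<in> alg_auto I" and g: "g \<in> alg_auto I"
  shows "f \<otimes>\<^bsub>Aut I\<^esub> g \<in> alg_auto I"
proof -
  interpret ring "quot_alg I"
    by (rule ideal.quotient_is_ring[OF ideal])
  let ?h = "compose (carrier (quot_alg I)) f g"
  have "?h \<in> ring_hom (quot_alg I) (quot_alg I)"
    using f g unfolding alg_auto_def
    by (intro ring_hom_memI) (auto simp: compose_def ring_hom_def Pi_iff)
  moreover have "?h \<in> Bij (carrier (quot_alg I))"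
    using f g unfolding alg_auto_def by (auto intro: compose_Bij)
  moreover have "?h (scalar I c) = scalar I c" for c
    using f g unfolding alg_auto_def by (auto simp: compose_def scalar_def)
  moreover have "f \<otimes>\<^bsub>Aut I\<^esub> g = ?h"
    using f g unfolding Aut_def BijGroup_def alg_auto_def by simp
  ultimately show ?thesis
    unfolding alg_auto_def by simp
qed

lemma Union_nonvanishing_loci:
  "\<Union> ((\<lambda>P. {f \<in> alg_auto I. P f \<noteq> 0}) ` polynomial_functions I) = alg_auto I"
proof -
  have "alg_auto I \<in> (\<lambda>P. {f \<in> alg_auto I. P f \<noteq> 0}) ` polynomial_functions I"
    by (rule image_eqI[OF _ polynomial_functions.const[of 1]]) simp
  then show ?thesis
    by blast
qed

lemma topspace_zariski: "topspace (zariski I) = alg_auto I"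
  unfolding zariski_def topology_generated_by_topspace carrier_Aut by (rule Union_nonvanishing_loci)

lemma openin_zariski_nonvanishing:
  "P \<in> polynomial_functions I \<Longrightarrow> openin (zariski I) {f \<in> alg_auto I. P f \<noteq> 0}"
  unfolding zariski_def carrier_Aut by (rule topology_generated_by_Basis) blast

lemma polynomial_functions_prod:
  "finite A \<Longrightarrow> (\<And>x. x \<in> A \<Longrightarrow> P x \<in> polynomial_functions I) \<Longrightarrow>
    (\<lambda>f. \<Prod>x\<in>A. P x f) \<in> polynomial_functions I"
  by (induction A rule: finite_induct) (auto intro: polynomial_functions.intros)

lemma linear_part_polynomial: "(\<lambda>f. linear_part f i j) \<in> polynomial_functions I"
  unfolding linear_part_def
  by (intro polynomial_functions.entry linear_functional_coeff_at std_basis_notin_supp residue_carrier)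

lemma openin_respects_replaceable: "openin (zariski I) {f \<in> alg_auto I. respects_replaceable f}"
proof -
  let ?\<Pi> = "{\<pi>. \<pi> permutes UNIV \<and> (\<forall>i. replaceable i (\<pi> i))}"
  have "{f \<in> alg_auto I. respects_replaceable f}
      = (\<Union>\<pi>\<in>?\<Pi>. {f \<in> alg_auto I. (\<Prod>i\<in>UNIV. linear_part f i (\<pi> i)) \<noteq> 0})"
    using respects_replaceable_iff_matching by auto
  also have "openin (zariski I) \<dots>"
  proof (rule openin_Union)
    fix U assume "U \<in> (\<lambda>\<pi>. {f \<in> alg_auto I. (\<Prod>i\<in>UNIV. linear_part f i (\<pi> i)) \<noteq> 0}) ` ?\<Pi>"
    then obtain \<pi> where U: "U = {f \<in> alg_auto I. (\<Prod>i\<in>UNIV. linear_part f i (\<pi> i)) \<noteq> 0}"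
      by blast
    show "openin (zariski I) U"
      unfolding U
      by (intro openin_zariski_nonvanishing polynomial_functions_prod linear_part_polynomial) simp
  qed
  finally show ?thesis .
qed

lemma openin_not_respects_replaceable:
  "openin (zariski I) {f \<in> alg_auto I. \<not> respects_replaceable f}"
proof -
  have "{f \<in> alg_auto I. \<not> respects_replaceable f}
      = (\<Union>(i, k)\<in>{(i, k). \<not> replaceable i k}. {f \<in> alg_auto I. linear_part f i k \<noteq> 0})"
    unfolding respects_replaceable_def by auto
  also have "openin (zariski I) \<dots>"
    by (auto intro!: openin_Union openin_zariski_nonvanishing linear_part_polynomial)
  finally show ?thesis .
qed

lemma Aut0_subset: "Aut0 I \<subseteq> alg_auto I"
  unfolding Aut0_def using connected_component_of_subset_topspace[of "zariski I"] topspace_zariski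
  by simp

lemma one_in_Aut0: "\<one>\<^bsub>Aut I\<^esub> \<in> Aut0 I"
  unfolding Aut0_def by (simp add: connected_component_of_refl topspace_zariski one_in_alg_auto)

lemma linear_part_eq_permutation:
  assumes "f (residue I (var i)) = residue I (var k)"
  shows "linear_part f i j = (if k = j then 1 else 0)"
  unfolding linear_part_def
  by (auto simp: assms coeff_at_residue std_basis_notin_supp lookup_single when_def)

lemma Aut0_respects_replaceable:
  assumes "f \<in> Aut0 I"
  shows "respects_replaceable f"
proof (rule ccontr)
  assume nresp: "\<not> respects_replaceable f"
  let ?Z = "{f \<in> alg_auto I. respects_replaceable f}" and ?N = "{f \<in> alg_auto I. \<not> respects_replaceable f}"
  have "connectedin (zariski I) (Aut0 I)"
    unfolding Aut0_def by (rule connectedin_connected_component_of)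
  moreover have "respects_replaceable \<one>\<^bsub>Aut I\<^esub>"
    unfolding respects_replaceable_def
    by (auto simp: linear_part_eq_permutation one_Aut_apply replaceable_refl split: if_splits)
  then have "?Z \<inter> Aut0 I \<noteq> {}"
    using one_in_Aut0 one_in_alg_auto by blast
  moreover have "?N \<inter> Aut0 I \<noteq> {}"
    using assms nresp Aut0_subset by blast
  ultimately show False
    using connectedinD[OF _ openin_respects_replaceable openin_not_respects_replaceable] Aut0_subset
    by blast
qed

text \<open>
  Composing a linear functional with \<open>t\<close> gives a linear functional. The pulled back function is
  only described on automorphisms, because the product is unspecified on other functions.
\<close>

lemma polynomial_functions_left_translation:
  assumes t: "t \<in> alg_auto I" and "P \<in> polynomial_functions I"
  shows "\<exists>Q\<in>polynomial_functions I. \<forall>f\<in>alg_auto I. P (t \<otimes>\<^bsub>Aut I\<^esub> f) = Q f"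
  using assms(2)
proof induction
  case (const c)
  show ?case
    by (rule bexI[OF _ polynomial_functions.const[of c]]) simp
next
  case (entry l a)
  have "linear_functional I (\<lambda>a. l (t a))"
  proof -
    have "scalar I c \<in> carrier (quot_alg I)" for c
      by (simp add: scalar_def)
    then show ?thesis
      using entry(1) t alg_auto_closed[OF t] unfolding linear_functional_def alg_auto_def
      by (auto simp: ring_hom_def)
  qed
  then have "(\<lambda>f. l (t (f a))) \<in> polynomial_functions I"
    using polynomial_functions.entry[of I "\<lambda>a. l (t a)"] entry(2) by blast
  then show ?case
    by (rule bexI[rotated]) (simp add: mult_Aut_apply t entry(2))
next
  case (add P Q)
  then show ?case
    using polynomial_functions.add by (metis (no_types, lifting))
next
  case (mult P Q)
  then show ?case
    using polynomial_functions.mult by (metis (no_types, lifting))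
qed

lemma continuous_left_translation:
  assumes t: "t \<in> alg_auto I"
  shows "continuous_map (zariski I) (zariski I) (\<lambda>f. t \<otimes>\<^bsub>Aut I\<^esub> f)"
proof -
  have "continuous_map (zariski I) (topology_generated_by
      ((\<lambda>P. {f \<in> alg_auto I. P f \<noteq> 0}) ` polynomial_functions I)) (\<lambda>f. t \<otimes>\<^bsub>Aut I\<^esub> f)"
  proof (rule continuous_on_generated_topo)
    fix U assume "U \<in> (\<lambda>P. {f \<in> alg_auto I. P f \<noteq> 0}) ` polynomial_functions I"
    then obtain P where P: "P \<in> polynomial_functions I" and U: "U = {f \<in> alg_auto I. P f \<noteq> 0}"
      by blast
    obtain Q where Q: "Q \<in> polynomial_functions I" "\<And>f. f \<in> alg_auto I \<Longrightarrow> P (t \<otimes>\<^bsub>Aut I\<^esub> f) = Q f"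
      using polynomial_functions_left_translation[OF t P] by blast
    have "(\<lambda>f. t \<otimes>\<^bsub>Aut I\<^esub> f) -` U \<inter> topspace (zariski I) = {f \<in> alg_auto I. Q f \<noteq> 0}"
      unfolding U topspace_zariski using Q(2) mult_in_alg_auto[OF t] by auto
    then show "openin (zariski I) ((\<lambda>f. t \<otimes>\<^bsub>Aut I\<^esub> f) -` U \<inter> topspace (zariski I))"
      using openin_zariski_nonvanishing[OF Q(1)] by simp
  next
    show "(\<lambda>f. t \<otimes>\<^bsub>Aut I\<^esub> f) ` topspace (zariski I) \<subseteq>
        \<Union> ((\<lambda>P. {f \<in> alg_auto I. P f \<noteq> 0}) ` polynomial_functions I)"
      unfolding topspace_zariski Union_nonvanishing_loci using mult_in_alg_auto[OF t] by blast
  qed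
  then show ?thesis
    by (simp add: zariski_def carrier_Aut)
qed

text \<open>
  The multiplication need not be jointly continuous, but continuity of left translations is enough:
  the translate by \<open>t\<close> of the component of the identity is connected and contains \<open>t\<close>.
\<close>

lemma mult_in_Aut0:
  assumes t: "t \<in> Aut0 I" and f: "f \<in> Aut0 I"
  shows "t \<otimes>\<^bsub>Aut I\<^esub> f \<in> Aut0 I"
proof -
  have t': "t \<in> alg_auto I"
    using t Aut0_subset by blast
  have "t \<otimes>\<^bsub>Aut I\<^esub> \<one>\<^bsub>Aut I\<^esub> = t"
    by (rule alg_auto_eqI)
       (simp_all add: t' mult_in_alg_auto one_in_alg_auto mult_Aut_apply one_Aut_apply)
  moreover have "connectedin (zariski I) ((\<lambda>f. t \<otimes>\<^bsub>Aut I\<^esub> f) ` Aut0 I)"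
    by (rule connectedin_continuous_map_image[OF continuous_left_translation[OF t']])
       (simp add: Aut0_def connectedin_connected_component_of)
  ultimately have "connected_component_of (zariski I) t (t \<otimes>\<^bsub>Aut I\<^esub> f)"
    unfolding connected_component_of_def using one_in_Aut0 f by (metis imageI)
  moreover have "connected_component_of (zariski I) \<one>\<^bsub>Aut I\<^esub> t"
    using t unfolding Aut0_def by simp
  ultimately show ?thesis
    unfolding Aut0_def using connected_component_of_trans by fastforce
qed

end

section \<open>Substitution endomorphisms\<close>

text \<open>
  The endomorphism of the polynomial algebra that sends \<open>x\<^sub>i\<close> to \<open>y i\<close>.
\<close>

definition subst :: "('n::finite \<Rightarrow> ('n, 'k::field) octant_algebra) \<Rightarrow>
    ('n, 'k) octant_algebra \<Rightarrow> ('n, 'k) octant_algebra" where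
  "subst y p = (\<Sum>m\<in>keys p. cst (lookup p m) * (\<Prod>i\<in>UNIV. y i ^ lookup m i))"

lemma subst_eq_sum_superset:
  assumes "finite A" "keys p \<subseteq> A"
  shows "subst y p = (\<Sum>m\<in>A. cst (lookup p m) * (\<Prod>i\<in>UNIV. y i ^ lookup m i))"
  unfolding subst_def using assms by (intro sum.mono_neutral_left) (auto simp: in_keys_iff)

lemma subst_add: "subst y (p + q) = subst y p + subst y q"
proof -
  have fin: "finite (keys p \<union> keys q)"
    by simp
  show ?thesis
    using keys_add[of p q]
    by (simp add: subst_eq_sum_superset[OF fin] lookup_add single_add distrib_right sum.distrib)
qed

lemma subst_single: "subst y (Poly_Mapping.single m c) = cst c * (\<Prod>i\<in>UNIV. y i ^ lookup m i)"
  by (subst subst_eq_sum_superset[where A = "{m}"]) auto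

lemma subst_cst: "subst y (cst c) = cst c"
  by (simp add: subst_single)

lemma subst_one: "subst y 1 = 1"
  using subst_cst[of y 1] by simp

lemma subst_var: "subst y (var i) = y i"
proof -
  have "(\<Prod>k\<in>UNIV. y k ^ lookup (std_basis i) k) = (\<Prod>k\<in>UNIV. if i = k then y k else 1)"
    by (intro prod.cong) (auto simp: lookup_single when_def)
  then show ?thesis
    by (simp add: subst_single)
qed

lemma subst_single_mult:
  fixes y :: "'a::finite \<Rightarrow> ('a, 'b::field) octant_algebra"
  shows
  "subst y (Poly_Mapping.single m c * p) = subst y (Poly_Mapping.single m c) * subst y p"
proof (induction p rule: poly_mapping_additive_induct)
  case (single m' c')
  have "cst (c * c') = (cst c * cst c' :: ('a, 'b) octant_algebra)"
    by (simp add: mult_single)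
  then show ?case
    by (simp add: mult_single[of m] subst_single lookup_add power_add prod.distrib ac_simps)
qed (simp_all add: distrib_left subst_add subst_def[of y 0])

lemma subst_mult: "subst y (p * q) = subst y p * subst y q"
  by (induction p rule: poly_mapping_additive_induct)
     (simp_all add: distrib_right subst_add subst_single_mult subst_def[of y 0])

lemma subst_monomial_step:
  "subst y (monomial (std_basis i + m)) = y i * subst y (monomial m)"
  by (simp add: monomial_add subst_mult subst_var)

lemma subst_subst: "subst y (subst z p) = subst (\<lambda>i. subst y (z i)) p"
proof (induction p rule: poly_mapping_additive_induct)
  case (single m c)
  show ?case
  proof -
    have "subst y (subst z (monomial m)) = subst (\<lambda>i. subst y (z i)) (monomial m)"
      by (induction m rule: octant_induct)
         (simp_all add: subst_one subst_monomial_step subst_mult)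
    then show ?thesis
      unfolding single_eq_cst_mult[of m c] by (simp only: subst_mult subst_cst)
  qed
qed (simp_all add: subst_add subst_def[of _ 0])

lemma subst_var_id: "subst var p = (p :: ('a::finite, 'b::field) octant_algebra)"
proof (induction p rule: poly_mapping_additive_induct)
  case (single m c)
  show ?case
  proof -
    have "subst var (monomial m) = (monomial m :: ('a, 'b) octant_algebra)"
      by (induction m rule: octant_induct)
         (simp_all add: subst_one subst_monomial_step, simp add: monomial_add)
    then show ?thesis
      unfolding single_eq_cst_mult[of m c] by (simp only: subst_mult subst_cst)
  qed
qed (simp_all add: subst_add subst_def[of _ 0])

section \<open>The line from the identity to a permutation of the variables\<close>

text \<open>
  The line through the identity, at \<open>t = 0\<close>, and the permutation \<open>\<sigma>\<close> of the variables, at \<open>t = 1\<close>, in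
  the space of linear substitutions.
\<close>

definition line :: "('n::finite \<Rightarrow> 'n) \<Rightarrow> 'k::field \<Rightarrow> 'n \<Rightarrow> ('n, 'k) octant_algebra" where
  "line \<sigma> t k = cst (1 - t) * var k + cst t * var (\<sigma> k)"

text \<open>
  The line lies in the algebra spanned by the identity and the involution \<open>\<sigma>\<close>. The formula for the
  parameter of the product comes from the value \<open>1 - 2t\<close> that \<open>(1 - t) id + t \<sigma>\<close> takes at \<open>\<sigma> = -1\<close>:
  \<open>(1 - 2s)(1 - 2t) = 1 - 2(s + t - 2st)\<close>.
\<close>

lemma subst_line_line:
  assumes "\<And>k. \<sigma> (\<sigma> k) = k"
  shows "subst (line \<sigma> t) (line \<sigma> s k) = line \<sigma> (s + t - 2 * s * t) k"
proof -
  have "subst (line \<sigma> t) (line \<sigma> s k) =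
      (cst (1 - s) * cst (1 - t) + cst s * cst t) * var k +
      (cst (1 - s) * cst t + cst s * cst (1 - t)) * var (\<sigma> k)"
    unfolding line_def
    by (simp only: subst_add subst_mult subst_cst subst_var assms) (simp add: algebra_simps)
  also have "cst (1 - s) * cst (1 - t) + cst s * cst t = cst (1 - (s + t - 2 * s * t))"
    by (simp add: mult_single algebra_simps flip: single_add)
  also have "cst (1 - s) * cst t + cst s * cst (1 - t) = cst (s + t - 2 * s * t)"
    by (simp add: mult_single algebra_simps flip: single_add)
  finally show ?thesis
    unfolding line_def .
qed

lemma line_0: "line \<sigma> 0 = var"
  by (simp add: line_def fun_eq_iff)

text \<open>
  The parameter \<open>s = t / (2t - 1)\<close> of the inverse solves \<open>(1 - 2s)(1 - 2t) = 1\<close>.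
\<close>

lemma subst_line_inverse:
  assumes "\<And>k. \<sigma> (\<sigma> k) = k" and "2 * t \<noteq> 1"
  shows "subst (line \<sigma> (t / (2 * t - 1))) (subst (line \<sigma> t) p) = p"
    and "subst (line \<sigma> t) (subst (line \<sigma> (t / (2 * t - 1))) p) = p"
proof -
  have "t + t / (2 * t - 1) - 2 * t * (t / (2 * t - 1)) = 0"
    using assms(2) by (simp add: divide_simps) (simp add: algebra_simps)
  then show "subst (line \<sigma> (t / (2 * t - 1))) (subst (line \<sigma> t) p) = p"
      and "subst (line \<sigma> t) (subst (line \<sigma> (t / (2 * t - 1))) p) = p"
    by (simp_all add: subst_subst subst_line_line assms(1) line_0 subst_var_id ac_simps)
qed

lemma line_1: "line \<sigma> 1 k = var (\<sigma> k)"
  by (simp add: line_def)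

lemma keys_line: "keys (line \<sigma> t k) \<subseteq> {std_basis k, std_basis (\<sigma> k)}"
proof -
  have "keys (line \<sigma> t k) \<subseteq> keys (cst (1 - t) * var k) \<union> keys (cst t * var (\<sigma> k))"
    unfolding line_def by (rule keys_add)
  then show ?thesis
    by (auto simp: mult_single split: if_splits)
qed

text \<open>
  The polynomial \<open>q\<close> has coefficients in the polynomial algebra. Evaluating it at constants keeps
  track of the dependence on \<open>t\<close> of all coefficients of the substitution at once.
\<close>

lemma subst_line_polynomial: "\<exists>q. \<forall>t. subst (line \<sigma> t) p = poly q (cst t)"
proof (induction p rule: poly_mapping_additive_induct)
  case zero
  show ?case
    by (rule exI[of _ 0]) (simp add: subst_def)
next
  case (add p p')
  then obtain q q' where "\<And>t. subst (line \<sigma> t) p = poly q (cst t)" "\<And>t. subst (line \<sigma> t) p' = poly q' (cst t)"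
    by blast
  then show ?case
    by (intro exI[of _ "q + q'"]) (simp add: subst_add)
next
  case (single m c)
  show ?case
  proof (induction m rule: octant_induct)
    case zero
    show ?case
      by (rule exI[of _ "[:cst c:]"]) (simp add: subst_cst)
  next
    case (step i m)
    then obtain q where q: "\<And>t. subst (line \<sigma> t) (Poly_Mapping.single m c) = poly q (cst t)"
      by blast
    have line: "line \<sigma> t i = poly [:var i, var (\<sigma> i) - var i:] (cst t)" for t
    proof -
      have eq: "cst (1 - t) = 1 - cst t"
        by (simp add: single_diff)
      show ?thesis
        unfolding line_def eq by (simp add: algebra_simps)
    qed
    have "subst (line \<sigma> t) (Poly_Mapping.single (std_basis i + m) c)
        = poly ([:var i, var (\<sigma> i) - var i:] * q) (cst t)" for t
    proof -
      have "Poly_Mapping.single (std_basis i + m) c = var i * Poly_Mapping.single m c"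
        by (simp add: mult_single)
      then show ?thesis
        by (simp only: subst_mult subst_var q line poly_mult)
    qed
    then show ?case
      by blast
  qed
qed

context full_monomial_ideal
begin

text \<open>
  Each monomial of the image of \<open>x\<^sup>m\<close> arises from \<open>x\<^sup>m\<close> by replacing some factors \<open>x\<^sub>k\<close> by the variable
  with index \<open>\<sigma> k\<close>.
\<close>

lemma subst_line_ideal:
  assumes \<sigma>: "\<And>k. replaceable k (\<sigma> k)" and p: "p \<in> I"
  shows "subst (line \<sigma> t) p \<in> I"
proof -
  \<comment> \<open>The induction replaces the factors of \<open>x\<^sup>m\<close> one at a time. The cofactor \<open>x\<^sup>d\<close> holds those that are
    not being processed, since the smaller monomial need not lie in \<open>I\<close> by itself.\<close>
  have "n + d \<in> supp I" if "m + d \<in> supp I" "n \<in> keys (subst (line \<sigma> t) (monomial m))" for m d n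
    using that
  proof (induction m arbitrary: d n rule: octant_induct)
    case zero
    then show ?case
      by (simp add: subst_one)
  next
    case (step i m)
    have "keys (subst (line \<sigma> t) (monomial (std_basis i + m)))
        \<subseteq> {a + b | a b. a \<in> keys (line \<sigma> t i) \<and> b \<in> keys (subst (line \<sigma> t) (monomial m))}"
      unfolding subst_monomial_step by (rule keys_mult)
    then obtain a b where ab: "n = a + b" "a \<in> keys (line \<sigma> t i)"
        "b \<in> keys (subst (line \<sigma> t) (monomial m))"
      using step.prems(2) by blast
    have "m + (std_basis i + d) \<in> supp I"
      using step.prems(1) by (simp add: ac_simps)
    then have "b + (std_basis i + d) \<in> supp I"
      using step.IH ab(3) by blast
    then have "std_basis i + (b + d) \<in> supp I"
      by (simp add: ac_simps)
    moreover have "a = std_basis i \<or> a = std_basis (\<sigma> i)"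
      using ab(2) keys_line[of \<sigma> t i] by blast
    ultimately have "a + (b + d) \<in> supp I"
      using \<sigma>[of i] unfolding replaceable_def by blast
    then show ?case
      by (simp add: ab(1) ac_simps)
  qed
  from this[of _ 0] have mono: "subst (line \<sigma> t) (monomial m) \<in> I" if "m \<in> supp I" for m
    using that unfolding mem_ideal_iff by auto
  have "(\<Sum>m\<in>A. cst (lookup p m) * (\<Prod>i\<in>UNIV. line \<sigma> t i ^ lookup m i)) \<in> I"
    if "finite A" "A \<subseteq> keys p" for A
    using that
  proof (induction A)
    case (insert m A)
    then have "m \<in> supp I"
      using p unfolding mem_ideal_iff by blast
    then have "(\<Prod>i\<in>UNIV. line \<sigma> t i ^ lookup m i) \<in> I"
      using mono[of m] by (simp add: subst_single)
    then show ?case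
      using insert by (auto intro: ideal_add ideal_mult_left)
  qed (simp add: ideal_zero)
  from this[of "keys p"] show ?thesis
    unfolding subst_def by simp
qed

lemma alg_auto_of_subst:
  assumes y: "\<And>p. p \<in> I \<Longrightarrow> subst y p \<in> I" and z: "\<And>p. p \<in> I \<Longrightarrow> subst z p \<in> I"
    and zy: "\<And>p. subst z (subst y p) = p" and yz: "\<And>p. subst y (subst z p) = p"
  shows "\<exists>f\<in>alg_auto I. \<forall>p. f (residue I p) = residue I (subst y p)"
proof -
  let ?A = "carrier (quot_alg I)"
  define ind where "ind y = (\<lambda>a\<in>?A. residue I (subst y (SOME p. a = residue I p)))"
    for y :: "'n \<Rightarrow> ('n, 'k) octant_algebra"
  have ind: "ind y (residue I p) = residue I (subst y p)" if y: "\<And>p. p \<in> I \<Longrightarrow> subst y p \<in> I" for y p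
  proof -
    define q where "q = (SOME q. residue I p = residue I q)"
    have "residue I p = residue I q"
      unfolding q_def by (rule someI) (rule refl)
    then have "p - q \<in> I"
      by (simp add: residue_eq_iff cong_def)
    then have "subst y (p - q) \<in> I"
      by (rule y)
    moreover have "subst y p = subst y (p - q) + subst y q"
      by (simp flip: subst_add)
    ultimately have "subst y p \<equiv>\<^sub>I subst y q"
      by (simp add: cong_def)
    then have "residue I (subst y q) = residue I (subst y p)"
      unfolding residue_eq_iff by (rule cong_sym)
    moreover have "ind y (residue I p) = residue I (subst y q)"
      unfolding ind_def q_def by simp
    ultimately show ?thesis
      by simp
  qed
  have "bij_betw (ind y) ?A ?A"
    by (rule bij_betw_byWitness[where f' = "ind z"])
       (auto simp: carrier_quot ind[OF y] ind[OF z] zy yz)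
  then have "ind y \<in> Bij ?A"
    unfolding Bij_def by (simp add: ind_def)
  moreover have "ind y \<in> ring_hom (quot_alg I) (quot_alg I)"
    using subst_cst[of y 1]
    by (intro ring_hom_memI)
       (auto simp: carrier_quot residue_add residue_mult residue_one ind[OF y] subst_add subst_mult)
  moreover have "ind y (scalar I c) = scalar I c" for c
    by (simp add: scalar_def ind[OF y] subst_cst)
  ultimately have "ind y \<in> alg_auto I"
    unfolding alg_auto_def by blast
  then show ?thesis
    using ind[OF y] by blast
qed

section \<open>Connectedness of a line of automorphisms\<close>

lemma linear_functional_poly:
  assumes "linear_functional I l"
  shows "\<exists>h. \<forall>t. l (residue I (poly q (cst t))) = poly h t"
proof (induction q)
  case 0
  have "l (residue I 0) = l (residue I 0) + l (residue I 0)"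
    using assms residue_add[of 0 0] unfolding linear_functional_def
    by (metis add_0 residue_carrier)
  then show ?case
    by (intro exI[of _ 0]) simp
next
  case (pCons a q)
  then obtain h where h: "\<And>t. l (residue I (poly q (cst t))) = poly h t"
    by blast
  have "l (residue I (poly (pCons a q) (cst t))) = poly (pCons (l (residue I a)) h) t" for t
  proof -
    have "l (residue I (poly (pCons a q) (cst t)))
        = l (residue I a \<oplus>\<^bsub>quot_alg I\<^esub> (scalar I t \<otimes>\<^bsub>quot_alg I\<^esub> residue I (poly q (cst t))))"
      by (simp add: scalar_def residue_mult residue_add)
    also have "\<dots> = l (residue I a) + l (scalar I t \<otimes>\<^bsub>quot_alg I\<^esub> residue I (poly q (cst t)))"
      using assms unfolding linear_functional_def
      by (simp add: scalar_def residue_mult)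
    also have "l (scalar I t \<otimes>\<^bsub>quot_alg I\<^esub> residue I (poly q (cst t))) = t * poly h t"
      using assms h unfolding linear_functional_def by simp
    finally show ?thesis
      by simp
  qed
  then show ?case
    by blast
qed

lemma polynomial_functions_along_line:
  assumes F: "\<And>t p. t \<in> T \<Longrightarrow> F t (residue I p) = residue I (subst (line \<sigma> t) p)"
    and P: "P \<in> polynomial_functions I"
  shows "\<exists>h. \<forall>t\<in>T. P (F t) = poly h t"
  using P
proof induction
  case (const c)
  show ?case
    by (rule exI[of _ "[:c:]"]) simp
next
  case (entry l a)
  then obtain p where a: "a = residue I p"
    unfolding carrier_quot by blast
  obtain q where q: "\<And>t. subst (line \<sigma> t) p = poly q (cst t)"
    using subst_line_polynomial by metis
  obtain h where "\<And>t. l (residue I (poly q (cst t))) = poly h t"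
    using linear_functional_poly[OF entry(1)] by metis
  then show ?case
    using F by (intro exI[of _ h]) (simp add: a q)
next
  case (add P Q)
  then obtain h h' where "\<forall>t\<in>T. P (F t) = poly h t" "\<forall>t\<in>T. Q (F t) = poly h' t"
    by blast
  then show ?case
    by (intro exI[of _ "h + h'"]) simp
next
  case (mult P Q)
  then obtain h h' where "\<forall>t\<in>T. P (F t) = poly h t" "\<forall>t\<in>T. Q (F t) = poly h' t"
    by blast
  then show ?case
    by (intro exI[of _ "h * h'"]) simp
qed

text \<open>
  The preimage in \<open>T\<close> of a basic open set is the complement of the zero set of a polynomial in \<open>t\<close>,
  hence empty or cofinite; this passes to all open sets. Two nonempty open subsets of the line meet,
  because the field is infinite.
\<close>

lemma connectedin_line:
  assumes F: "\<And>t. t \<in> T \<Longrightarrow> F t \<in> alg_auto I"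
    and line: "\<And>t p. t \<in> T \<Longrightarrow> F t (residue I p) = residue I (subst (line \<sigma> t) p)"
    and T: "finite (UNIV - T)"
  shows "connectedin (zariski I) (F ` T)"
proof -
  have cofinite: "finite (T - F -` U)" if "openin (zariski I) U" "F ` T \<inter> U \<noteq> {}" for U
  proof -
    have "generate_topology_on ((\<lambda>P. {f \<in> alg_auto I. P f \<noteq> 0}) ` polynomial_functions I) U"
      using that(1) unfolding zariski_def carrier_Aut by (rule openin_topology_generated_by)
    then show ?thesis
      using that(2)
    proof induction
      case (Int U V)
      have "finite (T - F -` U)" "finite (T - F -` V)"
        using Int by blast+
      then show ?case
        by (rule finite_subset[rotated, OF finite_UnI]) blast
    next
      case (UN K)
      then obtain U where U: "U \<in> K" "F ` T \<inter> U \<noteq> {}"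
        by blast
      then have "finite (T - F -` U)"
        using UN by blast
      then show ?case
        by (rule finite_subset[rotated]) (use U in blast)
    next
      case (Basis U)
      then obtain P where P: "P \<in> polynomial_functions I" and U: "U = {f \<in> alg_auto I. P f \<noteq> 0}"
        by blast
      obtain h where h: "\<And>t. t \<in> T \<Longrightarrow> P (F t) = poly h t"
        using polynomial_functions_along_line[OF line P] by blast
      then have "h \<noteq> 0"
        using Basis(2) U by auto
      then have "finite {t. poly h t = 0}"
        by (rule poly_roots_finite)
      then show ?case
        by (rule finite_subset[rotated]) (use h F in \<open>auto simp: U\<close>)
    qed simp
  qed
  show ?thesis
    unfolding connectedin
  proof (intro conjI notI)
    show "F ` T \<subseteq> topspace (zariski I)"
      using F by (auto simp: topspace_zariski)
    assume "\<exists>E1 E2. openin (zariski I) E1 \<and> openin (zariski I) E2 \<and> F ` T \<subseteq> E1 \<union> E2 \<and>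
        E1 \<inter> E2 \<inter> F ` T = {} \<and> E1 \<inter> F ` T \<noteq> {} \<and> E2 \<inter> F ` T \<noteq> {}"
    then obtain E1 E2 where E: "openin (zariski I) E1" "openin (zariski I) E2"
        "E1 \<inter> E2 \<inter> F ` T = {}" "F ` T \<inter> E1 \<noteq> {}" "F ` T \<inter> E2 \<noteq> {}"
      by blast
    have "finite ((UNIV - T) \<union> (T - F -` E1) \<union> (T - F -` E2))"
      using T cofinite E by blast
    moreover have "(UNIV - T) \<union> (T - F -` E1) \<union> (T - F -` E2) = UNIV"
      using E(3) by blast
    ultimately show False
      using infinite_UNIV_char_0[where 'a = 'k] by simp
  qed
qed

section \<open>Toric transpositions in the identity component\<close>

definition octant_swap :: "'n \<Rightarrow> 'n \<Rightarrow> 'n octant \<Rightarrow> 'n octant" where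
  "octant_swap i j = Poly_Mapping.map_key (Transposition.transpose i j)"

lemma octant_swap_std_basis: "octant_swap i j (std_basis k) = std_basis (Transposition.transpose i j k)"
proof -
  have "Poly_Mapping.map_key (Transposition.transpose i j)
      (Poly_Mapping.single (Transposition.transpose i j (Transposition.transpose i j k)) 1)
      = std_basis (Transposition.transpose i j k)"
    by (rule map_key_single) simp
  then show ?thesis
    unfolding octant_swap_def by simp
qed

lemma octant_swap_add: "octant_swap i j (m + m') = octant_swap i j m + octant_swap i j m'"
  unfolding octant_swap_def by (rule map_key_plus) simp

lemma octant_swap_swap: "octant_swap i j (octant_swap i j m) = m"
  unfolding octant_swap_def
  by (intro poly_mapping_eqI) (simp add: map_key.rep_eq)

lemma octant_auto_swap: "octant_auto (octant_swap i j)"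
  unfolding octant_auto_def using octant_swap_add octant_swap_swap by (metis o_bij comp_def eq_id_iff)

text \<open>
  The line for the transposition \<open>\<sigma>\<close> of \<open>i\<close> and \<open>j\<close> consists of automorphisms except at \<open>t = 1/2\<close>,
  where it is singular, and it connects the identity to the transposition.
\<close>

lemma toric_transposition_in_Aut0:
  assumes "i \<noteq> j" "replaceable i j" "replaceable j i"
  obtains f where "toric_transposition I i j f" "f \<in> Aut0 I"
    "\<And>k. f (residue I (var k)) = residue I (var (Transposition.transpose i j k))"
proof -
  let ?\<sigma> = "Transposition.transpose i j"
  let ?T = "{t :: 'k. 2 * t \<noteq> 1}"
  have inv: "?\<sigma> (?\<sigma> k) = k" for k
    by simp
  have repl: "replaceable k (?\<sigma> k)" for k
    using assms replaceable_refl by (auto simp: Transposition.transpose_def)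
  have "\<exists>f\<in>alg_auto I. \<forall>p. f (residue I p) = residue I (subst (line ?\<sigma> t) p)" if "t \<in> ?T" for t
  proof -
    have t: "2 * t \<noteq> 1"
      using that by simp
    show ?thesis
      by (rule alg_auto_of_subst[OF subst_line_ideal[OF repl] subst_line_ideal[OF repl]
            subst_line_inverse(1)[OF inv t] subst_line_inverse(2)[OF inv t]])
  qed
  then obtain F where F: "\<And>t. t \<in> ?T \<Longrightarrow> F t \<in> alg_auto I"
      and line: "\<And>t p. t \<in> ?T \<Longrightarrow> F t (residue I p) = residue I (subst (line ?\<sigma> t) p)"
    by metis
  have half: "UNIV - ?T = {1 / 2}"
    by (auto simp: field_simps)
  have conn: "connectedin (zariski I) (F ` ?T)"
    by (rule connectedin_line[OF F line]) (simp_all add: half)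
  have T01: "0 \<in> ?T" "1 \<in> ?T"
    by simp_all
  have one: "F 0 = \<one>\<^bsub>Aut I\<^esub>"
    by (rule alg_auto_eqI)
       (use F[OF T01(1)] line[OF T01(1)] in \<open>simp_all add: one_in_alg_auto one_Aut_apply line_0 subst_var_id\<close>)
  have Aut0: "F 1 \<in> Aut0 I"
    unfolding Aut0_def connected_component_of_def mem_Collect_eq
  proof (intro exI conjI)
    show "\<one>\<^bsub>Aut I\<^esub> \<in> F ` ?T"
      unfolding one[symmetric] using T01(1) by (rule imageI)
    show "F 1 \<in> F ` ?T"
      using T01(2) by (rule imageI)
  qed (rule conn)
  have "subst (line ?\<sigma> (1 :: 'k)) (monomial m) = monomial (octant_swap i j m)" for m
  proof (induction m rule: octant_induct)
    case zero
    have "octant_swap i j 0 = 0"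
      using octant_swap_add[of i j 0 0] by simp
    then show ?case
      by (simp add: subst_one)
  next
    case (step k m)
    show ?case
      unfolding subst_monomial_step step
      by (simp add: line_1 octant_swap_add octant_swap_std_basis monomial_add)
  qed
  note monomial = this
  then have F1: "F 1 (residue I (monomial m)) = residue I (monomial (octant_swap i j m))" for m
    using line[OF T01(2)] by simp
  have "octant_swap i j m \<in> supp I" if "m \<in> supp I" for m
    using subst_line_ideal[where \<sigma> = ?\<sigma> and t = 1, OF repl] that unfolding supp_def
    by (simp flip: monomial)
  then have "octant_swap i j ` supp I = supp I"
    by (metis octant_swap_swap image_subsetI image_eqI subsetI subset_antisym)
  then have "toric_induced I (octant_swap i j) (F 1)"
    unfolding toric_induced_def using octant_auto_swap F[OF T01(2)] F1 by (simp add: carrier_Aut)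
  then have "toric_transposition I i j (F 1)"
    unfolding toric_transposition_def using assms(1)
    by (intro conjI exI[of _ "octant_swap i j"]) (simp_all add: octant_swap_std_basis)
  then show ?thesis
    using that Aut0 F1 by (simp add: octant_swap_std_basis)
qed

end

section \<open>Toric automorphisms in the identity component\<close>

text \<open>
  A semigroup automorphism preserves the atoms of the octant.
\<close>

lemma octant_auto_permutes_std_basis:
  fixes g :: "'n::finite octant \<Rightarrow> 'n octant"
  assumes "octant_auto g"
  obtains \<sigma> where "bij \<sigma>" and "\<And>i. g (std_basis i) = std_basis (\<sigma> i)"
proof -
  have g: "bij g" "\<And>m m'. g (m + m') = g m + g m'"
    using assms unfolding octant_auto_def by auto
  have g0: "g 0 = 0"
    using g(2)[of 0 0] by simp
  have inj: "g m = g m' \<longleftrightarrow> m = m'" for m m'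
    using g(1) by (auto dest: bij_is_inj injD)
  have "\<exists>j. g (std_basis i) = std_basis j" for i
  proof -
    have "g (std_basis i) \<noteq> 0"
      using inj[of "std_basis i" 0] g0 by simp
    then obtain j m' where j: "g (std_basis i) = std_basis j + m'"
      by (rule octant_nonzero_split)
    obtain a b where ab: "g a = std_basis j" "g b = m'"
      using g(1) by (metis bij_pointE)
    then have "a + b = std_basis i"
      using j g(2) inj by metis
    moreover have "a \<noteq> 0"
      using ab(1) g0 by auto
    ultimately have "b = 0"
      unfolding add_eq_std_basis_iff by blast
    then show ?thesis
      using j ab(2) g0 by auto
  qed
  then obtain \<sigma> where \<sigma>: "\<And>i. g (std_basis i) = std_basis (\<sigma> i)"
    by metis
  have "inj \<sigma>"
    by (rule injI) (metis \<sigma> inj std_basis_inject)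
  then show ?thesis
    using that \<sigma> finite_UNIV_inj_surj by (metis bij_def finite)
qed

context full_monomial_ideal
begin

lemma toric_auto_permutation:
  assumes "\<tau> \<in> toric_auto I"
  obtains \<sigma> where "\<tau> \<in> alg_auto I" and "bij \<sigma>"
    and "\<And>i. \<tau> (residue I (var i)) = residue I (var (\<sigma> i))"
proof -
  obtain g where g: "toric_induced I g \<tau>"
    using assms unfolding toric_auto_def by blast
  then have "octant_auto g"
    unfolding toric_induced_def by blast
  then obtain \<sigma> where "bij \<sigma>" "\<And>i. g (std_basis i) = std_basis (\<sigma> i)"
    using octant_auto_permutes_std_basis by metis
  then show ?thesis
    using that g unfolding toric_induced_def carrier_Aut by metis
qed

text \<open>
  Composing with the transposition of \<open>i\<close> and \<open>\<sigma> i\<close> makes \<open>i\<close> a fixed point and keeps all other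
  fixed points. The transposed variables are equivalent, so the new permutation still moves each
  variable to one by which it is replaceable.
\<close>

lemma product_of_transpositions:
  assumes "\<tau> \<in> alg_auto I" and "bij \<sigma>" and "\<And>i. replaceable i (\<sigma> i)"
    and "\<And>k. \<tau> (residue I (var k)) = residue I (var (\<sigma> k))"
  shows "\<exists>ts. (\<forall>t\<in>set ts. (\<exists>i j. toric_transposition I i j t) \<and> t \<in> Aut0 I) \<and>
      \<tau> = foldr (\<otimes>\<^bsub>Aut I\<^esub>) ts \<one>\<^bsub>Aut I\<^esub>"
  using assms
proof (induction "card {i. \<sigma> i \<noteq> i}" arbitrary: \<sigma> \<tau> rule: less_induct)
  case less
  show ?case
  proof (cases "\<exists>i. \<sigma> i \<noteq> i")
    case False
    have "\<tau> = \<one>\<^bsub>Aut I\<^esub>"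
      by (rule alg_auto_eqI) (use less.prems False in \<open>simp_all add: one_in_alg_auto one_Aut_apply\<close>)
    then show ?thesis
      by (intro exI[of _ "[]"]) simp
  next
    case True
    then obtain i where i: "\<sigma> i \<noteq> i"
      by blast
    define j where "j = \<sigma> i"
    have "i \<noteq> j" and ij: "replaceable i j" "replaceable j i"
      using i less.prems(3) replaceable_permutation_sym[OF less.prems(2,3)] by (auto simp: j_def)
    then obtain t where t: "toric_transposition I i j t" "t \<in> Aut0 I"
        "\<And>k. t (residue I (var k)) = residue I (var (Transposition.transpose i j k))"
      using toric_transposition_in_Aut0 by metis
    have t': "t \<in> alg_auto I"
      using t(2) Aut0_subset by blast
    define \<sigma>' where "\<sigma>' = Transposition.transpose i j \<circ> \<sigma>"
    define \<tau>' where "\<tau>' = t \<otimes>\<^bsub>Aut I\<^esub> \<tau>"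
    have \<tau>': "\<tau>' \<in> alg_auto I"
      unfolding \<tau>'_def by (rule mult_in_alg_auto[OF t' less.prems(1)])
    have "replaceable k (\<sigma>' k)" for k
    proof -
      have "replaceable l (Transposition.transpose i j l)" for l
        using ij replaceable_refl by (auto simp: Transposition.transpose_def)
      then show ?thesis
        unfolding \<sigma>'_def comp_def using less.prems(3) replaceable_trans by blast
    qed
    moreover have "bij \<sigma>'"
      unfolding \<sigma>'_def using less.prems(2) by (simp add: bij_comp)
    moreover have "\<tau>' (residue I (var k)) = residue I (var (\<sigma>' k))" for k
      unfolding \<tau>'_def \<sigma>'_def by (simp add: mult_Aut_apply t' less.prems(1,4) t(3))
    moreover have "card {k. \<sigma>' k \<noteq> k} < card {k. \<sigma> k \<noteq> k}"
    proof (rule psubset_card_mono)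
      have "\<sigma>' i = i"
        by (simp add: \<sigma>'_def j_def)
      moreover have "\<sigma>' k = k" if "\<sigma> k = k" for k
      proof -
        have "k \<noteq> i" "k \<noteq> j"
          using that i less.prems(2) by (auto simp: j_def dest: bij_is_inj injD)
        then show ?thesis
          using that by (simp add: \<sigma>'_def)
      qed
      ultimately show "{k. \<sigma>' k \<noteq> k} \<subset> {k. \<sigma> k \<noteq> k}"
        using i by blast
    qed simp
    ultimately obtain ts where ts: "\<forall>t\<in>set ts. (\<exists>i j. toric_transposition I i j t) \<and> t \<in> Aut0 I"
        "\<tau>' = foldr (\<otimes>\<^bsub>Aut I\<^esub>) ts \<one>\<^bsub>Aut I\<^esub>"
      using less.hyps[of \<sigma>' \<tau>'] \<tau>' by blast
    \<comment> \<open>Since \<open>\<tau>' = t \<tau>\<close>, this says that \<open>t\<close> is an involution.\<close>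
    have "\<tau> = t \<otimes>\<^bsub>Aut I\<^esub> \<tau>'"
    proof (rule alg_auto_eqI)
      show "t \<otimes>\<^bsub>Aut I\<^esub> \<tau>' \<in> alg_auto I"
        by (rule mult_in_alg_auto[OF t' \<tau>'])
      show "\<tau> (residue I (var k)) = (t \<otimes>\<^bsub>Aut I\<^esub> \<tau>') (residue I (var k))" for k
        unfolding \<tau>'_def
        by (simp add: mult_Aut_apply t' less.prems(1,4) t(3) mult_in_alg_auto)
    qed (rule less.prems(1))
    then show ?thesis
      using ts t(1,2) by (intro exI[of _ "t # ts"]) auto
  qed
qed

lemma foldr_in_Aut0:
  "(\<And>t. t \<in> set ts \<Longrightarrow> t \<in> Aut0 I) \<Longrightarrow> foldr (\<otimes>\<^bsub>Aut I\<^esub>) ts \<one>\<^bsub>Aut I\<^esub> \<in> Aut0 I"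
  by (induction ts) (simp_all add: one_in_Aut0 mult_in_Aut0)

lemma toric_Aut0_replaceable:
  assumes "\<tau> \<in> Aut0 I" and "\<And>k. \<tau> (residue I (var k)) = residue I (var (\<sigma> k))"
  shows "replaceable i (\<sigma> i)"
  using Aut0_respects_replaceable[OF assms(1)]
    linear_part_eq_permutation[of \<tau> i "\<sigma> i" "\<sigma> i", OF assms(2)]
  unfolding respects_replaceable_def by simp

end

theorem proposition4p18:
  fixes I :: "('n::finite, 'k::field_char_0) octant_algebra set"
  assumes "monomial_ideal I" and "cofinite_support I" and "full I"
    and "\<tau> \<in> toric_auto I"
  shows "\<tau> \<in> Aut0 I \<longleftrightarrow>
    (\<exists>ts. (\<forall>t\<in>set ts. (\<exists>i j. toric_transposition I i j t) \<and> t \<in> Aut0 I) \<and>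
          \<tau> = foldr (\<otimes>\<^bsub>Aut I\<^esub>) ts \<one>\<^bsub>Aut I\<^esub>)"
proof -
  interpret full_monomial_ideal I
    using assms(1-3) by unfold_locales
  obtain \<sigma> where \<sigma>: "\<tau> \<in> alg_auto I" "bij \<sigma>"
      "\<And>i. \<tau> (residue I (var i)) = residue I (var (\<sigma> i))"
    using toric_auto_permutation[OF assms(4)] by metis
  show ?thesis
  proof
    assume "\<tau> \<in> Aut0 I"
    from product_of_transpositions[OF \<sigma>(1,2) toric_Aut0_replaceable[OF this \<sigma>(3)] \<sigma>(3)]
    show "\<exists>ts. (\<forall>t\<in>set ts. (\<exists>i j. toric_transposition I i j t) \<and> t \<in> Aut0 I) \<and>
        \<tau> = foldr (\<otimes>\<^bsub>Aut I\<^esub>) ts \<one>\<^bsub>Aut I\<^esub>" .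
  next
    assume "\<exists>ts. (\<forall>t\<in>set ts. (\<exists>i j. toric_transposition I i j t) \<and> t \<in> Aut0 I) \<and>
        \<tau> = foldr (\<otimes>\<^bsub>Aut I\<^esub>) ts \<one>\<^bsub>Aut I\<^esub>"
    then show "\<tau> \<in> Aut0 I"
      using foldr_in_Aut0 by blast
  qed
qed

end
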